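(* Let $m\ge2$, $N>2m$ and let $\mathcal{K}\subset\mathbb{R}^N$ be a compact set with $\mathrm{cap}_{m,\mathbb{R}^N}(\mathcal{K})>0$. Let $f\in C^\infty(\mathbb{R}^N)$ and consider the set $Z_f^{\mathcal{K}}:=\{x\in\mathcal{K}: f(x)=0\}$. If $\mathrm{cap}_{m,\mathbb{R}^N}(Z_f^{\mathcal{K}})<\mathrm{cap}_{m,\mathbb{R}^N}(\mathcal{K})$, then $\mathrm{cap}_{m,\mathbb{R}^N}(\mathcal{K},f)>0$.
   Context: Functions are real valued. $\nabla^m f:=\Delta^{m/2}f$ if $m$ is even and $\nabla^m f:=\nabla\Delta^{(m-1)/2}f$ if $m$ is odd. For $N>2m$, $D^{m,2}_0(\mathbb{R}^N)$ is the completion of $C_0^\infty(\mathbb{R}^N)$ for the norm $\|\nabla^m\cdot\|_{L^2(\mathbb{R}^N)}$ (a space of functions, embedded in $L^{2N/(N-2m)}(\mathbb{R}^N)$), and for $K\subset\mathbb{R}^N$ compact $D^{m,2}_0(\mathbb{R}^N\setminus K)$ is the closure in it of $C_0^\infty(\mathbb{R}^N\setminus K)$. For $u\in H^m_{loc}(\mathbb{R}^N)$ and $K$ compact, $\mathrm{cap}_{m,\mathbb{R}^N}(K,u):=\inf\{\int_{\mathbb{R}^N}|\nabla^m g|^2: g\in D^{m,2}_0(\mathbb{R}^N),\ g-\eta_K u\in D^{m,2}_0(\mathbb{R}^N\setminus K)\}$, where $\eta_K\in C_0^\infty(\mathbb{R}^N)$ is any function equal to $1$ in a neighbourhood of $K$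 (the value does not depend on $\eta_K$); $\mathrm{cap}_{m,\mathbb{R}^N}(K):=\mathrm{cap}_{m,\mathbb{R}^N}(K,1)$. *)

theory Defs
  imports "HOL-Analysis.Analysis"
begin

text \<open>
  The space \<open>\<real>\<^sup>N\<close> is a type \<open>'a :: euclidean_space\<close> with \<open>N = DIM('a)\<close>, equipped with Lebesgue measure.
\<close>

definition partial_deriv :: "'a::euclidean_space \<Rightarrow> ('a \<Rightarrow> real) \<Rightarrow> 'a \<Rightarrow> real" where
  "partial_deriv b f x = frechet_derivative f (at x) b"

text \<open>
  \<open>C\<^sup>\<infinity>(\<real>\<^sup>N)\<close>: every iterated partial derivative, in any order of the coordinates, is
  (Frechet) differentiable everywhere. In particular all of them are continuous.
\<close>

definition smooth :: "('a::euclidean_space \<Rightarrow> real) \<Rightarrow> bool" where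
  "smooth f \<longleftrightarrow>
     (\<forall>bs. set bs \<subseteq> Basis \<longrightarrow> (\<forall>x. foldr partial_deriv bs f differentiable (at x)))"

definition test_functions :: "'a::euclidean_space set \<Rightarrow> ('a \<Rightarrow> real) set" where
  "test_functions \<Omega> =
     {\<phi>. smooth \<phi> \<and> compact (closure {x. \<phi> x \<noteq> 0}) \<and> closure {x. \<phi> x \<noteq> 0} \<subseteq> \<Omega>}"

definition gradient :: "('a::euclidean_space \<Rightarrow> real) \<Rightarrow> 'a \<Rightarrow> 'a" where
  "gradient f x = (\<Sum>b\<in>Basis. partial_deriv b f x *\<^sub>R b)"

definition laplacian :: "('a::euclidean_space \<Rightarrow> real) \<Rightarrow> 'a \<Rightarrow> real" where
  "laplacian f x = (\<Sum>b\<in>Basis. partial_deriv b (partial_deriv b f) x)"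

text \<open>
  The pointwise length \<open>\<bar>\<nabla>\<^sup>m f\<bar>\<close>. Only the length is defined, since \<open>\<nabla>\<^sup>m f\<close> is scalar
  for even \<open>m\<close> and a vector field for odd \<open>m\<close>.
\<close>

definition norm_nabla :: "nat \<Rightarrow> ('a::euclidean_space \<Rightarrow> real) \<Rightarrow> 'a \<Rightarrow> real" where
  "norm_nabla m f x =
     (if even m then \<bar>(laplacian ^^ (m div 2)) f x\<bar>
      else norm (gradient ((laplacian ^^ ((m - 1) div 2)) f) x))"

definition test_energy :: "nat \<Rightarrow> ('a::euclidean_space \<Rightarrow> real) \<Rightarrow> real" where
  "test_energy m \<phi> = (LINT x|lebesgue. (norm_nabla m \<phi> x)\<^sup>2)"

definition critical_exponent :: "nat \<Rightarrow> 'a::euclidean_space itself \<Rightarrow> real" where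
  "critical_exponent m _ = 2 * real DIM('a) / (real DIM('a) - 2 * real m)"

text \<open>
  The completion of \<open>C\<^sub>0\<^sup>\<infinity>(\<real>\<^sup>N)\<close>, realised inside \<open>L\<^sup>p\<close> with \<open>p = 2N/(N-2m)\<close>: the element given by a
  sequence that is Cauchy for \<open>\<parallel>\<nabla>\<^sup>m \<cdot>\<parallel>\<close> in \<open>L\<^sup>2\<close> is identified with its \<open>L\<^sup>p\<close> limit. Elements are
  represented by measurable functions, so membership is invariant under a.e. equality.
  As \<open>p\<close> shows, this is meaningful for \<open>2m < N\<close> only.
\<close>

definition represents ::
    "nat \<Rightarrow> (nat \<Rightarrow> 'a::euclidean_space \<Rightarrow> real) \<Rightarrow> ('a \<Rightarrow> real) \<Rightarrow> bool" where
  "represents m \<phi> g \<longleftrightarrow>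
     (\<forall>k. \<phi> k \<in> test_functions UNIV) \<and>
     (\<forall>e>0. \<exists>M. \<forall>j\<ge>M. \<forall>k\<ge>M. test_energy m (\<lambda>x. \<phi> j x - \<phi> k x) < e) \<and>
     g \<in> borel_measurable lebesgue \<and>
     (\<lambda>k. \<integral>\<^sup>+x. ennreal (\<bar>\<phi> k x - g x\<bar> powr critical_exponent m TYPE('a)) \<partial>lebesgue)
       \<longlonglongrightarrow> 0"

definition D0 :: "nat \<Rightarrow> ('a::euclidean_space \<Rightarrow> real) set" where
  "D0 m = {g. \<exists>\<phi>. represents m \<phi> g}"

text \<open>
  \<open>\<integral>\<bar>\<nabla>\<^sup>m g\<bar>\<^sup>2\<close> for \<open>g\<close> in the completion, i.e. the square of its norm there: the limit of the energies
  of any representing sequence (which does not depend on the sequence when \<open>2m < N\<close>).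
\<close>

definition energy :: "nat \<Rightarrow> ('a::euclidean_space \<Rightarrow> real) \<Rightarrow> real" where
  "energy m g = (THE E. \<exists>\<phi>. represents m \<phi> g \<and> (\<lambda>k. test_energy m (\<phi> k)) \<longlonglongrightarrow> E)"

text \<open>The closure of \<open>C\<^sub>0\<^sup>\<infinity>(\<Omega>)\<close> in \<open>D\<^sub>0\<^bsup>m,2\<^esup>(\<real>\<^sup>N)\<close>.\<close>

definition D0_on :: "nat \<Rightarrow> 'a::euclidean_space set \<Rightarrow> ('a \<Rightarrow> real) set" where
  "D0_on m \<Omega> =
     {g \<in> D0 m. \<exists>\<psi>. (\<forall>k. \<psi> k \<in> test_functions \<Omega>) \<and>
                    (\<lambda>k. energy m (\<lambda>x. g x - \<psi> k x)) \<longlonglongrightarrow> 0}"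

definition is_cutoff :: "'a::euclidean_space set \<Rightarrow> ('a \<Rightarrow> real) \<Rightarrow> bool" where
  "is_cutoff K \<eta> \<longleftrightarrow>
     \<eta> \<in> test_functions UNIV \<and> (\<exists>U. open U \<and> K \<subseteq> U \<and> (\<forall>x\<in>U. \<eta> x = 1))"

definition cutoff :: "'a::euclidean_space set \<Rightarrow> 'a \<Rightarrow> real" where
  "cutoff K = (SOME \<eta>. is_cutoff K \<eta>)"

text \<open>
  Intended for compact \<open>K\<close>, \<open>2m < N\<close> and \<open>u\<close> in \<open>H\<^sup>m\<^sub>l\<^sub>o\<^sub>c(\<real>\<^sup>N)\<close>, in particular for every smooth \<open>u\<close>.
  The infimum is then over a nonempty set of nonnegative reals (\<open>g = \<eta>\<^sub>K u\<close> is admissible).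
\<close>

definition capacity ::
    "nat \<Rightarrow> 'a::euclidean_space set \<Rightarrow> ('a \<Rightarrow> real) \<Rightarrow> real" where
  "capacity m K u =
     Inf {energy m g | g. g \<in> D0 m \<and> (\<lambda>x. g x - cutoff K x * u x) \<in> D0_on m (- K)}"

abbreviation capacity1 :: "nat \<Rightarrow> 'a::euclidean_space set \<Rightarrow> real" where
  "capacity1 m K \<equiv> capacity m K (\<lambda>_. 1)"

end

theory Submission
  imports Defs "HOL-Computational_Algebra.Polynomial"
begin

text \<open>
  A capacity is an infimum of energies of test functions. A nearly optimal competitor for the zero set \<open>Z\<close>
  can be taken to be a test function \<open>\<phi>\<close> equal to \<open>1\<close> near \<open>Z\<close>, with energy below \<open>cap(K)\<close>. The
  difference \<open>\<eta>\<^sub>K - \<phi>\<close> then vanishes near \<open>Z\<close>, so near \<open>K\<close> it factors as \<open>h f\<close> for a test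
  function \<open>h\<close>. If \<open>cap(K, f) = 0\<close>, there are \<open>\<psi>\<close> vanishing near \<open>K\<close> with \<open>\<eta>\<^sub>K f + \<psi>\<close> of arbitrarily
  small energy. Multiplication by \<open>h\<close> is bounded for the energy (Leibniz rule and a weighted Hardy
  inequality, which needs \<open>N > 2m\<close>), so \<open>h (\<eta>\<^sub>K f + \<psi>)\<close> has small energy as well, and \<open>\<phi>\<close> is a competitor for
  \<open>cap(K)\<close>, a contradiction.
\<close>

section \<open>Calculus of smooth functions\<close>

text \<open>Read positively, cap(K, f) = 0 would give cap(K) \<le> cap(Z): every test function equal
  to 1 near Z would be a competitor for K. Smooth competitors matter because division by f needs a
  whole neighbourhood of Z on which the numerator vanishes; compactness then keeps |f| away from 0
  on the rest of K. Elements of the completion, known only almost everywhere, offer no such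
  neighbourhood. The bound for multiplication by h must have a constant independent of the function
  multiplied, because the supports of the functions of small energy are not controlled. A Poincare
  inequality on a fixed ball is therefore no help with the lower order terms of the Leibniz rule;
  weights decaying at infinity are. The energy is defined by iterated Laplacians, which do not suit
  a Leibniz induction; integration by parts replaces them by the tensor of all m-th derivatives. On
  the completion the energy is a definite description of a limit. It has a usable value only after a
  closability argument: a sequence that is Cauchy in energy and tends to 0 in
  \<open>L\<^sup>p\<close> has energies tending to 0.\<close>

lemma partial_deriv_eq:
  assumes "(f has_derivative D) (at x)"
  shows "partial_deriv b f x = D b"
  using frechet_derivative_at[OF assms] by (simp add: partial_deriv_def)

lemma partial_deriv_const [simp]: "partial_deriv b (\<lambda>x. c) = (\<lambda>x. 0)"
  by (auto simp: fun_eq_iff partial_deriv_def)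

lemma partial_deriv_add:
  assumes "f differentiable (at x)" "g differentiable (at x)"
  shows "partial_deriv b (\<lambda>x. f x + g x) x = partial_deriv b f x + partial_deriv b g x"
  using partial_deriv_eq[OF has_derivative_add] assms
  by (simp add: frechet_derivative_works partial_deriv_def)

lemma partial_deriv_mult:
  assumes "f differentiable (at x)" "g differentiable (at x)"
  shows "partial_deriv b (\<lambda>x. f x * g x) x = partial_deriv b f x * g x + f x * partial_deriv b g x"
  using partial_deriv_eq[OF has_derivative_mult,
      of f "frechet_derivative f (at x)" x g "frechet_derivative g (at x)" b] assms
  by (simp add: frechet_derivative_works partial_deriv_def)

lemma partial_deriv_inverse:
  assumes "f differentiable (at x)" "f x \<noteq> 0"
  shows "partial_deriv b (\<lambda>x. inverse (f x)) x = - partial_deriv b f x * (inverse (f x) * inverse (f x))"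
proof -
  have "(f has_derivative frechet_derivative f (at x)) (at x)"
    using assms(1) by (simp add: frechet_derivative_works)
  from partial_deriv_eq[OF Deriv.has_derivative_inverse[OF assms(2) this], of b] show ?thesis
    by (simp add: partial_deriv_def)
qed

lemma partial_deriv_compose:
  assumes "f differentiable (at x)" "(F has_real_derivative d) (at (f x))"
  shows "partial_deriv b (\<lambda>x. F (f x)) x = d * partial_deriv b f x"
proof -
  have "(f has_derivative frechet_derivative f (at x)) (at x)"
    using assms(1) by (simp add: frechet_derivative_works)
  moreover have "(F has_derivative (\<lambda>h. d * h)) (at (f x))"
    using assms(2) by (simp add: has_field_derivative_def)
  ultimately show ?thesis
    using partial_deriv_eq[OF has_derivative_compose, of f _ x F "(\<lambda>h. d * h)" b]
    by (simp add: partial_deriv_def)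
qed

lemma partial_deriv_transform_open:
  assumes "open S" "x \<in> S" "\<And>y. y \<in> S \<Longrightarrow> f y = c"
  shows "partial_deriv b f x = 0"
proof -
  have "(f has_derivative (\<lambda>_. 0)) (at x)"
    by (rule has_derivative_transform_within_open[OF _ assms(1,2), where f="\<lambda>_. c"]) (use assms in auto)
  from partial_deriv_eq[OF this] show ?thesis by simp
qed

text \<open>\<open>smooth\<close> speaks of all lists of directions at once and gives no induction:
  a derivative of a product is a sum of products of other functions. Counting orders makes the
  closure properties provable by induction on the order, with the functions generalised.\<close>

primrec differentiable_upto :: "nat \<Rightarrow> ('a::euclidean_space \<Rightarrow> real) \<Rightarrow> bool" where
  "differentiable_upto 0 f \<longleftrightarrow> True"
| "differentiable_upto (Suc n) f \<longleftrightarrow>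
     (\<forall>x. f differentiable (at x)) \<and> (\<forall>b\<in>Basis. differentiable_upto n (partial_deriv b f))"

lemma differentiable_upto_iff:
  "differentiable_upto n f \<longleftrightarrow>
     (\<forall>bs. set bs \<subseteq> Basis \<longrightarrow> length bs < n \<longrightarrow> (\<forall>x. foldr partial_deriv bs f differentiable (at x)))"
proof (induction n arbitrary: f)
  case (Suc n)
  show ?case (is "?L \<longleftrightarrow> ?R")
  proof
    assume L: ?L
    show ?R
    proof (intro allI impI)
      fix bs x assume bs: "set bs \<subseteq> (Basis::'a set)" "length bs < Suc n"
      \<comment> \<open>\<open>foldr\<close> applies the last list element first, so the recursion
        peels off the end of the list.\<close>
      show "foldr partial_deriv bs f differentiable (at x)"
        using L bs Suc.IH by (cases bs rule: rev_cases) auto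
    qed
  next
    assume R: ?R
    have "foldr partial_deriv bs (partial_deriv b f) differentiable (at x)"
      if "b \<in> Basis" "set bs \<subseteq> Basis" "length bs < n" for b bs x
      using R[rule_format, of "bs @ [b]" x] that by simp
    moreover have "f differentiable (at x)" for x
      using R[rule_format, of "[]" x] by simp
    ultimately show ?L using Suc.IH by simp
  qed
qed simp

lemma smooth_iff_differentiable_upto: "smooth f \<longleftrightarrow> (\<forall>n. differentiable_upto n f)"
  unfolding smooth_def differentiable_upto_iff by blast

lemma differentiable_upto_Suc: "differentiable_upto (Suc n) f \<Longrightarrow> differentiable_upto n f"
  unfolding differentiable_upto_iff by simp

lemma differentiable_upto_const: "differentiable_upto n (\<lambda>x. c)"
  by (induction n arbitrary: c) auto

lemma differentiable_upto_add:
  "differentiable_upto n f \<Longrightarrow> differentiable_upto n g \<Longrightarrow> differentiable_upto n (\<lambda>x. f x + g x)"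
proof (induction n arbitrary: f g)
  case (Suc n)
  have "partial_deriv b (\<lambda>x. f x + g x) = (\<lambda>x. partial_deriv b f x + partial_deriv b g x)" for b
    using Suc.prems by (auto simp: partial_deriv_add)
  then show ?case using Suc by auto
qed simp

lemma differentiable_upto_mult:
  "differentiable_upto n f \<Longrightarrow> differentiable_upto n g \<Longrightarrow> differentiable_upto n (\<lambda>x. f x * g x)"
proof (induction n arbitrary: f g)
  case (Suc n)
  have "partial_deriv b (\<lambda>x. f x * g x) = (\<lambda>x. partial_deriv b f x * g x + f x * partial_deriv b g x)" for b
    using Suc.prems by (auto simp: partial_deriv_mult)
  then show ?case
    using Suc.IH differentiable_upto_Suc[OF Suc.prems(1)] differentiable_upto_Suc[OF Suc.prems(2)] Suc.prems
    by (auto intro!: differentiable_upto_add)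
qed simp

lemma differentiable_upto_inverse:
  "differentiable_upto n f \<Longrightarrow> (\<And>x. f x \<noteq> 0) \<Longrightarrow> differentiable_upto n (\<lambda>x. inverse (f x))"
proof (induction n arbitrary: f)
  case (Suc n)
  have "partial_deriv b (\<lambda>x. inverse (f x))
      = (\<lambda>x. (-1) * (partial_deriv b f x * (inverse (f x) * inverse (f x))))" for b
    using Suc.prems by (auto simp: partial_deriv_inverse)
  moreover have "differentiable_upto n (\<lambda>x. inverse (f x))"
    using Suc.IH[OF differentiable_upto_Suc] Suc.prems by blast
  moreover have "differentiable_upto n
      (\<lambda>x. (-1) * (partial_deriv b f x * (inverse (f x) * inverse (f x))))" if "b \<in> Basis" for b
    using Suc.prems that calculation(2)
    by (intro differentiable_upto_mult differentiable_upto_const) auto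
  ultimately show ?case
    using Suc.prems by (auto intro!: differentiable_inverse)
qed simp

text \<open>The family \<open>S\<close> is closed under differentiation and so plays the role of a
  set of smooth functions of one variable. The induction must run over all of \<open>S\<close>,
  because the chain rule replaces \<open>F\<close> by its derivative.\<close>

lemma differentiable_upto_compose:
  assumes S: "\<And>F. F \<in> S \<Longrightarrow> \<exists>G\<in>S. \<forall>t. (F has_real_derivative G t) (at t)"
  shows "differentiable_upto n f \<Longrightarrow> F \<in> S \<Longrightarrow> differentiable_upto n (\<lambda>x. F (f x))"
proof (induction n arbitrary: F)
  case (Suc n)
  obtain G where G: "G \<in> S" "\<And>t. (F has_real_derivative G t) (at t)"
    using S Suc.prems(2) by blast
  have "partial_deriv b (\<lambda>x. F (f x)) = (\<lambda>x. G (f x) * partial_deriv b f x)" for b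
    using Suc.prems G by (auto simp: partial_deriv_compose)
  moreover have "differentiable_upto n (\<lambda>x. G (f x))"
    using Suc.IH[OF differentiable_upto_Suc] Suc.prems G(1) by blast
  moreover have "(\<lambda>x. F (f x)) differentiable (at x)" for x
    using Suc.prems(1) G(2)[of "f x"] real_differentiable_def
    by (metis differentiable_compose differentiable_upto.simps(2))
  ultimately show ?case
    using Suc.prems by (auto intro!: differentiable_upto_mult)
qed simp

lemma smooth_differentiable: "smooth f \<Longrightarrow> f differentiable (at x)"
  unfolding smooth_iff_differentiable_upto by (metis differentiable_upto.simps(2))

lemma smooth_partial_deriv: "smooth f \<Longrightarrow> b \<in> Basis \<Longrightarrow> smooth (partial_deriv b f)"
  unfolding smooth_iff_differentiable_upto by (metis differentiable_upto.simps(2))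

lemma smoothI:
  assumes "\<And>x. f differentiable (at x)" "\<And>b. b \<in> Basis \<Longrightarrow> smooth (partial_deriv b f)"
  shows "smooth f"
  unfolding smooth_iff_differentiable_upto
proof
  fix n show "differentiable_upto n f"
    using assms unfolding smooth_iff_differentiable_upto by (cases n) auto
qed

lemma smooth_isCont: "smooth f \<Longrightarrow> isCont f x"
  using smooth_differentiable differentiable_imp_continuous_within by blast

lemma smooth_continuous_on: "smooth f \<Longrightarrow> continuous_on S f"
  using smooth_isCont continuous_at_imp_continuous_on by blast

lemma smooth_const [simp]: "smooth (\<lambda>x. c)"
  by (simp add: smooth_iff_differentiable_upto differentiable_upto_const)

lemma smooth_add: "smooth f \<Longrightarrow> smooth g \<Longrightarrow> smooth (\<lambda>x. f x + g x)"
  by (simp add: smooth_iff_differentiable_upto differentiable_upto_add)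

lemma smooth_mult: "smooth f \<Longrightarrow> smooth g \<Longrightarrow> smooth (\<lambda>x. f x * g x)"
  by (simp add: smooth_iff_differentiable_upto differentiable_upto_mult)

lemma smooth_uminus: "smooth f \<Longrightarrow> smooth (\<lambda>x. - f x)"
  using smooth_mult[of "\<lambda>x. -1" f] by simp

lemma smooth_diff: "smooth f \<Longrightarrow> smooth g \<Longrightarrow> smooth (\<lambda>x. f x - g x)"
  using smooth_add[of f "\<lambda>x. - g x"] smooth_uminus[of g] by simp

lemma smooth_inverse: "smooth f \<Longrightarrow> (\<And>x. f x \<noteq> 0) \<Longrightarrow> smooth (\<lambda>x. inverse (f x))"
  by (simp add: smooth_iff_differentiable_upto differentiable_upto_inverse)

lemma smooth_power: "smooth f \<Longrightarrow> smooth (\<lambda>x. f x ^ n)"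
  by (induction n) (auto intro: smooth_mult)

lemma smooth_sum: "(\<And>i. i \<in> I \<Longrightarrow> smooth (f i)) \<Longrightarrow> smooth (\<lambda>x. \<Sum>i\<in>I. f i x)"
  by (induction I rule: infinite_finite_induct) (auto intro: smooth_add)

lemma partial_deriv_inner: "partial_deriv b (\<lambda>x. x \<bullet> a) = (\<lambda>x. b \<bullet> a)"
  by (rule ext, rule partial_deriv_eq[of _ "\<lambda>x. x \<bullet> a"]) (auto intro!: derivative_eq_intros)

lemma smooth_inner: "smooth (\<lambda>x. x \<bullet> a)"
proof (rule smoothI)
  show "(\<lambda>x. x \<bullet> a) differentiable at x" for x
    unfolding differentiable_def by (rule exI) (rule derivative_eq_intros | simp)+
qed (simp add: partial_deriv_inner)

lemma smooth_inner_self: "smooth (\<lambda>x. x \<bullet> x)"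
proof -
  have "smooth (\<lambda>x::'a. \<Sum>b\<in>Basis. (x \<bullet> b) * (x \<bullet> b))"
    by (intro smooth_sum smooth_mult smooth_inner)
  then show ?thesis by (simp add: euclidean_inner[symmetric])
qed

text \<open>The functions \<open>P(1/t) exp(-1/t)\<close>, extended by \<open>0\<close>, are closed under differentiation.\<close>

definition flat :: "real poly \<Rightarrow> real \<Rightarrow> real" where
  "flat P t = (if t > 0 then poly P (inverse t) * exp (- inverse t) else 0)"

lemma poly_times_exp_minus_tendsto_0:
  "((\<lambda>t::real. poly P t * exp (- t)) \<longlongrightarrow> 0) at_top"
proof -
  have "((\<lambda>t::real. \<Sum>i\<le>degree P. coeff P i * (t ^ i / exp t)) \<longlongrightarrow> (\<Sum>i\<le>degree P. coeff P i * 0)) at_top"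
    by (intro tendsto_intros tendsto_power_div_exp_0)
  moreover have "(\<lambda>t::real. \<Sum>i\<le>degree P. coeff P i * (t ^ i / exp t)) = (\<lambda>t. poly P t * exp (- t))"
    by (simp add: poly_altdef sum_distrib_right exp_minus divide_inverse mult.assoc)
  ultimately show ?thesis by simp
qed

text \<open>With s = 1/t the derivative of P(s) exp(-s) with respect to t is s^2 (P(s) - P'(s))
  exp(-s), and \<open>[:0, 0, 1:]\<close> is the polynomial s^2. At the origin the right difference
  quotient is s P(s) exp(-s), which tends to 0 as s grows.\<close>

lemma flat_has_derivative:
  "(flat P has_real_derivative flat ([:0, 0, 1:] * (P - pderiv P)) t) (at t)"
proof (cases t "0::real" rule: linorder_cases)
  case less
  show ?thesis
    by (rule has_field_derivative_transform_within_open[where f="\<lambda>_. 0" and S="{..<0}"])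
       (use less in \<open>auto simp: flat_def\<close>)
next
  case equal
  have "((\<lambda>h. flat P h / h) \<longlongrightarrow> 0) (at_right 0)"
  proof -
    have "((\<lambda>h. poly ([:0,1:] * P) (inverse h) * exp (- inverse h)) \<longlongrightarrow> 0) (at_right 0)"
      by (rule filterlim_compose[OF poly_times_exp_minus_tendsto_0 filterlim_inverse_at_top_right])
    moreover have "\<forall>\<^sub>F h in at_right 0.
        poly ([:0,1:] * P) (inverse h) * exp (- inverse h) = flat P h / h"
      using eventually_at_right_less[of 0]
      by eventually_elim (auto simp: flat_def field_simps)
    ultimately show ?thesis by (rule Lim_transform_eventually)
  qed
  moreover have "((\<lambda>h. flat P h / h) \<longlongrightarrow> 0) (at_left 0)"
    by (rule Lim_transform_eventually[where f="\<lambda>_. 0"])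
       (auto simp: eventually_at_filter flat_def)
  ultimately have "((\<lambda>h. flat P h / h) \<longlongrightarrow> 0) (at 0)"
    by (simp add: filterlim_at_split)
  then show ?thesis
    using equal by (simp add: has_field_derivative_iff flat_def[of _ 0])
next
  case greater
  have "((\<lambda>t. poly P (inverse t) * exp (- inverse t)) has_real_derivative
      flat ([:0, 0, 1:] * (P - pderiv P)) t) (at t)"
    using greater
    by (auto intro!: derivative_eq_intros poly_DERIV[THEN DERIV_chain2]
        simp: flat_def power2_eq_square field_simps)
  then show ?thesis
    by (rule has_field_derivative_transform_within_open[where S="{0<..}"])
       (use greater in \<open>auto simp: flat_def\<close>)
qed

lemma smooth_flat: "smooth f \<Longrightarrow> smooth (\<lambda>x. flat P (f x))"
  unfolding smooth_iff_differentiable_upto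
  using differentiable_upto_compose[of "range flat"] flat_has_derivative by blast

lemma flat_1_pos: "t > 0 \<Longrightarrow> flat 1 t > 0"
  and flat_1_nonneg: "flat 1 t \<ge> 0"
  and flat_nonpos: "t \<le> 0 \<Longrightarrow> flat P t = 0"
  by (auto simp: flat_def)

text \<open>Existence of one cutoff makes the choice in \<open>cutoff\<close> meaningful. The
  quotient below is a smooth step, equal to 0 for q \<le> 0 and to 1 for q \<ge> 1; the quadratic q
  exceeds 1 on the ball of radius R around K and is negative far out.\<close>

lemma is_cutoff_cutoff:
  assumes "compact (K::'a::euclidean_space set)"
  shows "is_cutoff K (cutoff K)"
proof -
  obtain R where R: "\<And>x. x \<in> K \<Longrightarrow> norm x < R"
    using compact_imp_bounded[OF assms] bounded_pos_less[of K] by blast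
  define q where "q x = R\<^sup>2 + 1 - x \<bullet> x" for x :: 'a
  have q: "smooth q" unfolding q_def by (intro smooth_diff smooth_inner_self smooth_const)
  \<comment> \<open>The numbers t and 1 - t are never both nonpositive, so the denominator of the
    step has no zero.\<close>
  have pos: "flat 1 t + flat 1 (1 - t) > 0" for t
    using flat_1_pos[of t] flat_1_pos[of "1 - t"] flat_1_nonneg[of t] flat_1_nonneg[of "1 - t"]
    by (cases "t > 0") auto
  define \<eta> where "\<eta> x = flat 1 (q x) * inverse (flat 1 (q x) + flat 1 (1 - q x))" for x
  have smooth: "smooth \<eta>"
    unfolding \<eta>_def using pos
    by (intro smooth_mult smooth_inverse smooth_add smooth_flat smooth_diff smooth_const q)
       (auto simp: less_imp_neq[THEN not_sym])
  have "{x. \<eta> x \<noteq> 0} \<subseteq> cball 0 (sqrt (R\<^sup>2 + 1))"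
  proof
    fix x assume "x \<in> {x. \<eta> x \<noteq> 0}"
    then have "q x > 0" using flat_nonpos[of "q x"] by (force simp: \<eta>_def)
    then show "x \<in> cball 0 (sqrt (R\<^sup>2 + 1))"
      by (simp add: q_def norm_eq_sqrt_inner)
  qed
  then have "compact (closure {x. \<eta> x \<noteq> 0})"
    using bounded_subset bounded_cball compact_closure by blast
  then have "\<eta> \<in> test_functions UNIV"
    using smooth by (simp add: test_functions_def)
  moreover have "\<forall>x\<in>ball 0 R. \<eta> x = 1"
  proof
    fix x :: 'a assume "x \<in> ball 0 R"
    then have "norm x ^ 2 < R\<^sup>2" by (simp add: power_strict_mono)
    then have "q x > 1" by (simp add: q_def power2_norm_eq_inner)
    then show "\<eta> x = 1" using flat_1_pos[of "q x"] by (simp add: \<eta>_def flat_nonpos)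
  qed
  moreover have "K \<subseteq> ball 0 R" using R by auto
  ultimately have "is_cutoff K \<eta>" unfolding is_cutoff_def by blast
  then show ?thesis unfolding cutoff_def by (rule someI[of "is_cutoff K"])
qed

section \<open>Test functions\<close>

lemma test_functions_smooth: "\<phi> \<in> test_functions \<Omega> \<Longrightarrow> smooth \<phi>"
  by (simp add: test_functions_def)

lemma test_functions_UNIV: "\<phi> \<in> test_functions \<Omega> \<Longrightarrow> \<phi> \<in> test_functions UNIV"
  by (simp add: test_functions_def)

lemma zero_outside_support: "x \<notin> closure {x. \<phi> x \<noteq> 0} \<Longrightarrow> \<phi> x = (0::real)"
  by (metis (mono_tags) closure_subset mem_Collect_eq subsetD)

lemma test_functions_support_subset:
  assumes "\<phi> \<in> test_functions \<Omega>" "smooth g" "\<And>x. x \<notin> closure {x. \<phi> x \<noteq> 0} \<Longrightarrow> g x = 0"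
  shows "g \<in> test_functions \<Omega>"
proof -
  have "closure {x. g x \<noteq> 0} \<subseteq> closure {x. \<phi> x \<noteq> 0}"
    using assms(3) by (intro closure_minimal) auto
  moreover from this have "compact (closure {x. g x \<noteq> 0})"
    using assms(1) compact_Int_closed[of "closure {x. \<phi> x \<noteq> 0}" "closure {x. g x \<noteq> 0}"]
    by (simp add: test_functions_def Int_absorb1)
  ultimately show ?thesis using assms(1,2) by (auto simp: test_functions_def)
qed

lemma test_functions_zero: "(\<lambda>x. 0) \<in> test_functions \<Omega>"
  by (simp add: test_functions_def)

lemma test_functions_mult:
  assumes "\<phi> \<in> test_functions \<Omega>" "smooth h"
  shows "(\<lambda>x. h x * \<phi> x) \<in> test_functions \<Omega>" "(\<lambda>x. \<phi> x * h x) \<in> test_functions \<Omega>"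
proof -
  show "(\<lambda>x. h x * \<phi> x) \<in> test_functions \<Omega>"
    by (rule test_functions_support_subset[OF assms(1)])
       (intro smooth_mult assms(2) test_functions_smooth[OF assms(1)], drule zero_outside_support, simp)
  show "(\<lambda>x. \<phi> x * h x) \<in> test_functions \<Omega>"
    by (rule test_functions_support_subset[OF assms(1)])
       (intro smooth_mult assms(2) test_functions_smooth[OF assms(1)], drule zero_outside_support, simp)
qed

lemma test_functions_add:
  assumes "\<phi> \<in> test_functions \<Omega>" "\<psi> \<in> test_functions \<Omega>"
  shows "(\<lambda>x. \<phi> x + \<psi> x) \<in> test_functions \<Omega>"
proof -
  let ?S = "closure {x. \<phi> x \<noteq> 0} \<union> closure {x. \<psi> x \<noteq> 0}"
  have S: "compact ?S" "?S \<subseteq> \<Omega>" using assms by (auto simp: test_functions_def)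
  have "{x. \<phi> x + \<psi> x \<noteq> 0} \<subseteq> ?S"
  proof
    fix x assume "x \<in> {x. \<phi> x + \<psi> x \<noteq> 0}"
    then have "\<phi> x \<noteq> 0 \<or> \<psi> x \<noteq> 0" by auto
    then show "x \<in> ?S" using zero_outside_support[of x \<phi>] zero_outside_support[of x \<psi>] by blast
  qed
  then have sub: "closure {x. \<phi> x + \<psi> x \<noteq> 0} \<subseteq> ?S"
    by (intro closure_minimal) auto
  then have "compact (closure {x. \<phi> x + \<psi> x \<noteq> 0})"
    using S(1) compact_Int_closed[OF S(1) closed_closure, of "{x. \<phi> x + \<psi> x \<noteq> 0}"]
    by (simp add: Int_absorb1)
  then show ?thesis
    using sub S(2) assms by (auto simp: test_functions_def intro: smooth_add)
qed

lemma test_functions_cmult: "\<phi> \<in> test_functions \<Omega> \<Longrightarrow> (\<lambda>x. c * \<phi> x) \<in> test_functions \<Omega>"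
  by (intro test_functions_mult smooth_const)

lemma test_functions_uminus: "\<phi> \<in> test_functions \<Omega> \<Longrightarrow> (\<lambda>x. - \<phi> x) \<in> test_functions \<Omega>"
  using test_functions_cmult[of \<phi> \<Omega> "-1"] by simp

lemma test_functions_diff:
  "\<phi> \<in> test_functions \<Omega> \<Longrightarrow> \<psi> \<in> test_functions \<Omega> \<Longrightarrow> (\<lambda>x. \<phi> x - \<psi> x) \<in> test_functions \<Omega>"
  using test_functions_add[of \<phi> \<Omega> "\<lambda>x. - \<psi> x"] test_functions_uminus[of \<psi>] by simp

lemma test_functions_sum:
  "(\<And>i. i \<in> I \<Longrightarrow> f i \<in> test_functions \<Omega>) \<Longrightarrow> (\<lambda>x. \<Sum>i\<in>I. f i x) \<in> test_functions \<Omega>"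
  by (induction I rule: infinite_finite_induct) (auto intro: test_functions_add test_functions_zero)

lemma test_functions_partial_deriv:
  assumes "\<phi> \<in> test_functions \<Omega>" "b \<in> Basis"
  shows "partial_deriv b \<phi> \<in> test_functions \<Omega>"
proof (rule test_functions_support_subset[OF assms(1)])
  show "smooth (partial_deriv b \<phi>)" using assms test_functions_smooth smooth_partial_deriv by blast
  fix x assume x: "x \<notin> closure {x. \<phi> x \<noteq> 0}"
  show "partial_deriv b \<phi> x = 0"
  proof (rule partial_deriv_transform_open[of "- closure {x. \<phi> x \<noteq> 0}"])
    show "\<phi> y = 0" if "y \<in> - closure {x. \<phi> x \<noteq> 0}" for y
      by (rule zero_outside_support) (use that in blast)
  qed (use x in auto)
qed

lemma test_functions_bound:
  assumes "\<phi> \<in> test_functions UNIV"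
  shows "\<exists>M R. M > 0 \<and> R > 0 \<and> (\<forall>x. \<bar>\<phi> x\<bar> \<le> M) \<and> (\<forall>x. norm x > R \<longrightarrow> \<phi> x = 0)"
proof -
  let ?S = "closure {x. \<phi> x \<noteq> 0}"
  have S: "compact ?S" using assms by (simp add: test_functions_def)
  have nz: "x \<in> ?S" if "\<phi> x \<noteq> 0" for x using that zero_outside_support[of x \<phi>] by blast
  have "compact (\<phi> ` ?S)"
    by (intro compact_continuous_image S smooth_continuous_on test_functions_smooth[OF assms])
  then obtain M where M: "M > 0" "\<forall>y\<in>\<phi> ` ?S. norm y \<le> M"
    using compact_imp_bounded bounded_pos by metis
  obtain R where R: "R > 0" "\<forall>x\<in>?S. norm x \<le> R"
    using compact_imp_bounded[OF S] bounded_pos by metis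
  have "\<bar>\<phi> x\<bar> \<le> M" for x using M nz[of x] by (cases "\<phi> x = 0") auto
  moreover have "\<phi> x = 0" if "norm x > R" for x
    using R(2) that nz[of x] by (meson not_le)
  ultimately show ?thesis using M(1) R(1) by blast
qed

section \<open>Measurability and integrability of test functions\<close>

lemma smooth_borel_measurable: "smooth f \<Longrightarrow> f \<in> borel_measurable borel"
  by (intro borel_measurable_continuous_onI smooth_continuous_on)

lemma smooth_lebesgue_measurable: "smooth f \<Longrightarrow> f \<in> borel_measurable lebesgue"
  by (rule measurable_completion) (simp add: smooth_borel_measurable)

text \<open>The Borel version serves the translation argument for integrals of derivatives; the
  completed version is the one in which energies are written.\<close>

lemma test_functions_integrable_lborel:
  assumes "\<phi> \<in> test_functions UNIV"
  shows "integrable lborel \<phi>"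
proof -
  let ?S = "closure {x. \<phi> x \<noteq> 0}"
  have "integrable lborel (\<lambda>x. indicator ?S x *\<^sub>R \<phi> x)"
    by (intro borel_integrable_compact smooth_continuous_on test_functions_smooth[OF assms])
       (use assms in \<open>simp add: test_functions_def\<close>)
  moreover have "(\<lambda>x. indicator ?S x *\<^sub>R \<phi> x) = \<phi>"
  proof
    fix x show "indicator ?S x *\<^sub>R \<phi> x = \<phi> x"
      by (cases "x \<in> ?S") (simp, metis mult_eq_0_iff real_scaleR_def zero_outside_support)
  qed
  ultimately show ?thesis by (simp only:)
qed

lemma test_functions_integrable:
  assumes "\<phi> \<in> test_functions UNIV"
  shows "integrable lebesgue \<phi>"
proof -
  have "\<phi> \<in> borel_measurable lborel"
    using smooth_borel_measurable[OF test_functions_smooth[OF assms]] by simp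
  then show ?thesis
    using test_functions_integrable_lborel[OF assms] integrable_completion by blast
qed

section \<open>Mean values along lines, symmetry of second derivatives, integration by parts\<close>

lemma line_has_derivative:
  assumes "smooth f"
  shows "((\<lambda>t. f (x + t *\<^sub>R b)) has_real_derivative partial_deriv b f (x + t *\<^sub>R b)) (at t)"
proof -
  have f: "(f has_derivative frechet_derivative f (at (x + t *\<^sub>R b))) (at (x + t *\<^sub>R b))"
    using smooth_differentiable[OF assms] frechet_derivative_works by blast
  have "((\<lambda>t. x + t *\<^sub>R b) has_derivative (\<lambda>h. h *\<^sub>R b)) (at t)"
    by (auto intro!: derivative_eq_intros)
  from has_derivative_compose[OF this f]
  have "((\<lambda>t. f (x + t *\<^sub>R b)) has_derivative
      (\<lambda>h. frechet_derivative f (at (x + t *\<^sub>R b)) (h *\<^sub>R b))) (at t)" .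
  moreover have "frechet_derivative f (at (x + t *\<^sub>R b)) (h *\<^sub>R b)
      = partial_deriv b f (x + t *\<^sub>R b) * h" for h
    using linear_cmul[OF has_derivative_linear[OF f]] by (simp add: partial_deriv_def)
  ultimately show ?thesis by (simp add: has_field_derivative_def)
qed

lemma line_mean_value:
  assumes "smooth f" "t > 0"
  shows "\<exists>\<xi>. 0 < \<xi> \<and> \<xi> < t \<and> f (x + t *\<^sub>R b) - f x = t * partial_deriv b f (x + \<xi> *\<^sub>R b)"
  using MVT2[of 0 t "\<lambda>t. f (x + t *\<^sub>R b)" "\<lambda>t. partial_deriv b f (x + t *\<^sub>R b)"]
    line_has_derivative[OF assms(1)] assms(2) by auto

text \<open>The mean value theorem is used twice: in direction \<open>a\<close> for the increment of
  \<open>f\<close> over \<open>t *\<^sub>R b\<close>, then in direction \<open>b\<close> for the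
  derivative so obtained. The left side is symmetric in \<open>a\<close> and \<open>b\<close>, the
  right side is not; symmetry of mixed derivatives comes from this contrast.\<close>

lemma second_difference:
  assumes "smooth f" "t > 0" "a \<in> Basis"
  shows "\<exists>\<xi> \<eta>. 0 < \<xi> \<and> \<xi> < t \<and> 0 < \<eta> \<and> \<eta> < t \<and>
    f (x + t *\<^sub>R a + t *\<^sub>R b) - f (x + t *\<^sub>R a) - f (x + t *\<^sub>R b) + f x
      = t * t * partial_deriv b (partial_deriv a f) (x + \<xi> *\<^sub>R a + \<eta> *\<^sub>R b)"
proof -
  let ?u = "\<lambda>s. f ((x + t *\<^sub>R b) + s *\<^sub>R a) - f (x + s *\<^sub>R a)"
  have "\<exists>\<xi>>0. \<xi> < t \<and> ?u t - ?u 0 = (t - 0) *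
      (partial_deriv a f ((x + t *\<^sub>R b) + \<xi> *\<^sub>R a) - partial_deriv a f (x + \<xi> *\<^sub>R a))"
    by (rule MVT2) (use assms in \<open>auto intro!: DERIV_diff line_has_derivative\<close>)
  then obtain \<xi> where \<xi>: "0 < \<xi>" "\<xi> < t" "?u t - ?u 0 = t *
      (partial_deriv a f ((x + t *\<^sub>R b) + \<xi> *\<^sub>R a) - partial_deriv a f (x + \<xi> *\<^sub>R a))"
    by auto
  obtain \<eta> where \<eta>: "0 < \<eta>" "\<eta> < t"
    "partial_deriv a f ((x + \<xi> *\<^sub>R a) + t *\<^sub>R b) - partial_deriv a f (x + \<xi> *\<^sub>R a)
      = t * partial_deriv b (partial_deriv a f) ((x + \<xi> *\<^sub>R a) + \<eta> *\<^sub>R b)"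
    using line_mean_value[OF smooth_partial_deriv[OF assms(1,3)] assms(2)] by blast
  have "f (x + t *\<^sub>R a + t *\<^sub>R b) - f (x + t *\<^sub>R a) - f (x + t *\<^sub>R b) + f x
      = t * t * partial_deriv b (partial_deriv a f) (x + \<xi> *\<^sub>R a + \<eta> *\<^sub>R b)"
    using \<xi>(3) \<eta>(3) by (simp add: algebra_simps)
  with \<xi> \<eta> show ?thesis by blast
qed

text \<open>One symmetric second difference, divided by t^2, is a value of either mixed derivative
  at some point within 2t of \<open>x\<close>. As t tends to 0, continuity of both mixed derivatives
  forces equality at \<open>x\<close>.\<close>

lemma partial_deriv_commute:
  fixes f :: "'a::euclidean_space \<Rightarrow> real"
  assumes "smooth f" "a \<in> Basis" "b \<in> Basis"
  shows "partial_deriv a (partial_deriv b f) = partial_deriv b (partial_deriv a f)"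
proof
  fix x :: 'a
  let ?P = "partial_deriv b (partial_deriv a f)" and ?Q = "partial_deriv a (partial_deriv b f)"
  have close: "dist (x + s *\<^sub>R c + r *\<^sub>R d) x \<le> 2 * t"
    if "0 < s" "s < t" "0 < r" "r < t" "c \<in> Basis" "d \<in> Basis" for s r t :: real and c d
  proof -
    have "dist (x + s *\<^sub>R c + r *\<^sub>R d) x = norm (s *\<^sub>R c + r *\<^sub>R d)" by (simp add: dist_norm add.assoc)
    also have "\<dots> \<le> s + r" using that norm_triangle_ineq[of "s *\<^sub>R c" "r *\<^sub>R d"] by simp
    finally show ?thesis using that by linarith
  qed
  have ex: "\<exists>p q. ?P p = ?Q q \<and> dist p x \<le> 2 * t \<and> dist q x \<le> 2 * t" if t: "t > 0" for t :: real
  proof -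
    obtain s r where 1: "0 < s" "s < t" "0 < r" "r < t"
      "f (x + t *\<^sub>R a + t *\<^sub>R b) - f (x + t *\<^sub>R a) - f (x + t *\<^sub>R b) + f x
       = t * t * ?P (x + s *\<^sub>R a + r *\<^sub>R b)"
      using second_difference[OF assms(1) t assms(2)] by blast
    obtain s' r' where 2: "0 < s'" "s' < t" "0 < r'" "r' < t"
      "f (x + t *\<^sub>R b + t *\<^sub>R a) - f (x + t *\<^sub>R b) - f (x + t *\<^sub>R a) + f x
       = t * t * ?Q (x + s' *\<^sub>R b + r' *\<^sub>R a)"
      using second_difference[OF assms(1) t assms(3)] by blast
    have swap: "x + t *\<^sub>R b + t *\<^sub>R a = x + t *\<^sub>R a + t *\<^sub>R b" by (simp add: algebra_simps)
    have "t * t * ?P (x + s *\<^sub>R a + r *\<^sub>R b) = t * t * ?Q (x + s' *\<^sub>R b + r' *\<^sub>R a)"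
      using 1(5) 2(5) unfolding swap by linarith
    then have "?P (x + s *\<^sub>R a + r *\<^sub>R b) = ?Q (x + s' *\<^sub>R b + r' *\<^sub>R a)"
      using t by simp
    then show ?thesis
      using close[OF 1(1-4) assms(2,3)] close[OF 2(1-4) assms(3,2)] by blast
  qed
  \<comment> \<open>The two points are packed into one pair, so that a single choice selects both
    sequences with matching values.\<close>
  have "\<forall>n. \<exists>r. ?P (fst r) = ?Q (snd r) \<and> dist (fst r) x \<le> 2 * inverse (real (Suc n)) \<and>
      dist (snd r) x \<le> 2 * inverse (real (Suc n))"
    unfolding split_paired_Ex fst_conv snd_conv by (intro allI ex) simp
  from choice[OF this] obtain r where r: "\<forall>n. ?P (fst (r n)) = ?Q (snd (r n)) \<and>
      dist (fst (r n)) x \<le> 2 * inverse (real (Suc n)) \<and> dist (snd (r n)) x \<le> 2 * inverse (real (Suc n))" ..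
  define p q where "p n = fst (r n)" and "q n = snd (r n)" for n
  have pq: "?P (p n) = ?Q (q n)" "dist (p n) x \<le> 2 * inverse (real (Suc n))"
    "dist (q n) x \<le> 2 * inverse (real (Suc n))" for n
    using r unfolding p_def q_def by blast+
  have inv: "(\<lambda>n. 2 * inverse (real (Suc n))) \<longlonglongrightarrow> 0"
    using tendsto_mult_left[OF LIMSEQ_inverse_real_of_nat, of 2] by simp
  have lim: "u \<longlonglongrightarrow> x" if u: "\<And>n. dist (u n) x \<le> 2 * inverse (real (Suc n))" for u :: "nat \<Rightarrow> 'a"
  proof -
    have "(\<lambda>n. dist (u n) x) \<longlonglongrightarrow> 0"
    proof (rule tendsto_sandwich[OF _ _ tendsto_const inv])
      show "\<forall>\<^sub>F n in sequentially. 0 \<le> dist (u n) x" by simp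
      show "\<forall>\<^sub>F n in sequentially. dist (u n) x \<le> 2 * inverse (real (Suc n))"
        by (rule always_eventually) (rule allI, rule u)
    qed
    then show ?thesis by (subst tendsto_dist_iff)
  qed
  have smooth: "smooth ?P" "smooth ?Q"
    by (simp_all add: smooth_partial_deriv assms)
  have "(\<lambda>n. ?P (p n)) \<longlonglongrightarrow> ?P x"
    by (rule isCont_tendsto_compose[OF smooth_isCont[OF smooth(1)] lim[OF pq(2)]])
  moreover have "(\<lambda>n. ?Q (q n)) \<longlonglongrightarrow> ?Q x"
    by (rule isCont_tendsto_compose[OF smooth_isCont[OF smooth(2)] lim[OF pq(3)]])
  ultimately show "?Q x = ?P x"
    unfolding pq(1) using LIMSEQ_unique[of "\<lambda>n. ?Q (q n)" "?Q x" "?P x"] by blast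
qed

text \<open>The integral is translation invariant, so that difference quotients integrate to zero.\<close>

lemma integral_partial_deriv:
  fixes \<phi> :: "'a::euclidean_space \<Rightarrow> real"
  assumes "\<phi> \<in> test_functions UNIV" "b \<in> Basis"
  shows "(LINT x|lebesgue. partial_deriv b \<phi> x) = 0"
proof -
  let ?d = "partial_deriv b \<phi>"
  have smooth: "smooth \<phi>" using assms(1) test_functions_smooth by blast
  have d: "?d \<in> test_functions UNIV" using assms test_functions_partial_deriv by blast
  obtain M where M: "M > 0" "\<forall>x. \<bar>?d x\<bar> \<le> M" using test_functions_bound[OF d] by blast
  obtain R where R: "R > 0" "\<forall>x. norm x > R \<longrightarrow> \<phi> x = 0" using test_functions_bound[OF assms(1)] by blast
  define t where "t n = inverse (real (Suc n))" for n
  have t: "t n > 0" "t n \<le> 1" for n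
    by (auto simp: t_def field_simps)
  have t_lim: "t \<longlonglongrightarrow> 0"
    unfolding t_def by (rule LIMSEQ_inverse_real_of_nat)
  define q where "q n x = (\<phi> (x + t n *\<^sub>R b) - \<phi> x) / t n" for n x
  have meas [measurable]: "\<phi> \<in> borel_measurable borel" "?d \<in> borel_measurable borel"
    using smooth_borel_measurable[OF smooth] smooth_borel_measurable[OF test_functions_smooth[OF d]] by simp_all
  \<comment> \<open>Domination: by the mean value theorem the quotients are bounded by the supremum
    of the derivative, and since the shifts have length at most 1 they vanish outside the ball of
    radius \<open>R + 1\<close>.\<close>
  have "(\<lambda>n. LINT x|lborel. q n x) \<longlonglongrightarrow> (LINT x|lborel. ?d x)"
  proof (rule integral_dominated_convergence[where w="\<lambda>x. M * indicator (cball 0 (R + 1)) x"])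
    show "?d \<in> borel_measurable lborel" "q n \<in> borel_measurable lborel" for n
      unfolding q_def by measurable
    show "integrable lborel (\<lambda>x. M * indicator (cball 0 (R + 1)) x)"
      by (rule integrable_mult_right, rule integrable_real_indicator[OF _ emeasure_bounded_finite]) auto
    show "AE x in lborel. (\<lambda>n. q n x) \<longlonglongrightarrow> ?d x"
    proof (rule AE_I2)
      fix x :: 'a
      have "((\<lambda>s. (\<phi> (x + s *\<^sub>R b) - \<phi> x) / s) \<longlongrightarrow> ?d x) (at 0)"
        using line_has_derivative[OF smooth, of x b 0] by (simp add: has_field_derivative_iff)
      moreover have "filterlim t (at 0) sequentially"
        using t_lim t(1) by (simp add: filterlim_at less_imp_neq[THEN not_sym])
      ultimately show "(\<lambda>n. q n x) \<longlonglongrightarrow> ?d x"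
        unfolding q_def by (rule filterlim_compose)
    qed
    show "AE x in lborel. norm (q n x) \<le> M * indicator (cball 0 (R + 1)) x" for n
    proof (rule AE_I2)
      fix x :: 'a
      obtain \<xi> where \<xi>: "\<phi> (x + t n *\<^sub>R b) - \<phi> x = t n * ?d (x + \<xi> *\<^sub>R b)"
        using line_mean_value[OF smooth t(1)[of n], of x b] by blast
      show "norm (q n x) \<le> M * indicator (cball 0 (R + 1)) x"
      proof (cases "norm x \<le> R + 1")
        case True
        then show ?thesis using \<xi> M(2) t(1)[of n] by (simp add: q_def)
      next
        case False
        have "norm x \<le> norm (x + t n *\<^sub>R b) + norm (t n *\<^sub>R b)"
          using norm_triangle_ineq4[of "x + t n *\<^sub>R b" "t n *\<^sub>R b"] by simp
        also have "norm (t n *\<^sub>R b) \<le> 1" using t(1,2)[of n] assms(2) by simp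
        finally have "norm (x + t n *\<^sub>R b) > R" using False by simp
        then have "q n x = 0" using R(2) False by (simp add: q_def)
        then show ?thesis using M(1) by (simp add: indicator_def)
      qed
    qed
  qed
  moreover have "(LINT x|lborel. q n x) = 0" for n
  proof -
    have int: "integrable lborel \<phi>" by (rule test_functions_integrable_lborel[OF assms(1)])
    have "(LINT x|lborel. \<phi> x) = (LINT x|distr lborel borel ((+) (t n *\<^sub>R b)). \<phi> x)"
      by (simp add: lborel_distr_plus)
    also have "\<dots> = (LINT x|lborel. \<phi> (t n *\<^sub>R b + x))"
      by (subst integral_distr) auto
    finally have eq: "(LINT x|lborel. \<phi> (x + t n *\<^sub>R b)) = (LINT x|lborel. \<phi> x)"
      by (simp add: add.commute)
    have "integrable (distr lborel borel ((+) (t n *\<^sub>R b))) \<phi>"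
      using int by (simp add: lborel_distr_plus)
    then have int': "integrable lborel (\<lambda>x. \<phi> (x + t n *\<^sub>R b))"
      by (subst (asm) integrable_distr_eq) (auto simp: add.commute)
    show ?thesis using int int' eq by (simp add: q_def)
  qed
  ultimately have "(LINT x|lborel. ?d x) = 0"
    using LIMSEQ_unique[of "\<lambda>_. 0::real", OF _ tendsto_const] by simp
  then show ?thesis by (simp add: integral_completion)
qed

text \<open>The product is a test function as soon as one factor is, so its derivative integrates to
  zero; the product rule then separates the two terms.\<close>

lemma integral_by_parts:
  assumes "\<phi> \<in> test_functions UNIV" "smooth \<psi>" "b \<in> Basis"
  shows "(LINT x|lebesgue. partial_deriv b \<phi> x * \<psi> x) = - (LINT x|lebesgue. \<phi> x * partial_deriv b \<psi> x)"
proof -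
  have smooth: "smooth \<phi>" using assms(1) test_functions_smooth by blast
  have "(LINT x|lebesgue. partial_deriv b (\<lambda>x. \<phi> x * \<psi> x) x) = 0"
    by (intro integral_partial_deriv test_functions_mult assms)
  moreover have "partial_deriv b (\<lambda>x. \<phi> x * \<psi> x) = (\<lambda>x. partial_deriv b \<phi> x * \<psi> x + \<phi> x * partial_deriv b \<psi> x)"
    by (intro ext partial_deriv_mult smooth_differentiable smooth assms)
  moreover have "integrable lebesgue (\<lambda>x. partial_deriv b \<phi> x * \<psi> x)"
    "integrable lebesgue (\<lambda>x. \<phi> x * partial_deriv b \<psi> x)"
    by (intro test_functions_integrable test_functions_mult test_functions_partial_deriv
        smooth_partial_deriv assms)+
  ultimately show ?thesis by simp
qed

section \<open>The energy as a quadratic form\<close>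

lemma partial_deriv_cmult:
  "smooth f \<Longrightarrow> partial_deriv b (\<lambda>x. c * f x) = (\<lambda>x. c * partial_deriv b f x)"
  by (simp add: fun_eq_iff partial_deriv_mult smooth_differentiable)

lemma partial_deriv_smooth_add:
  "smooth f \<Longrightarrow> smooth g \<Longrightarrow>
    partial_deriv b (\<lambda>x. f x + g x) = (\<lambda>x. partial_deriv b f x + partial_deriv b g x)"
  by (simp add: fun_eq_iff partial_deriv_add smooth_differentiable)

lemma partial_deriv_smooth_mult:
  "smooth f \<Longrightarrow> smooth g \<Longrightarrow>
    partial_deriv b (\<lambda>x. f x * g x) = (\<lambda>x. partial_deriv b f x * g x + f x * partial_deriv b g x)"
  by (simp add: fun_eq_iff partial_deriv_mult smooth_differentiable)

lemma partial_deriv_sum: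
  assumes "\<And>i. i \<in> I \<Longrightarrow> smooth (f i)"
  shows "partial_deriv b (\<lambda>x. \<Sum>i\<in>I. f i x) = (\<lambda>x. \<Sum>i\<in>I. partial_deriv b (f i) x)"
  using assms
proof (induction I rule: infinite_finite_induct)
  case (insert i I)
  then have "smooth (f i)" "smooth (\<lambda>x. \<Sum>i\<in>I. f i x)" by (auto intro: smooth_sum)
  with insert show ?case by (simp add: partial_deriv_smooth_add)
qed simp_all

lemma partial_deriv_laplacian:
  assumes "smooth f" "b \<in> Basis"
  shows "partial_deriv b (laplacian f) = laplacian (partial_deriv b f)"
proof -
  have "laplacian f = (\<lambda>x. \<Sum>a\<in>Basis. partial_deriv a (partial_deriv a f) x)"
    by (auto simp: laplacian_def)
  moreover have "partial_deriv b (\<lambda>x. \<Sum>a\<in>Basis. partial_deriv a (partial_deriv a f) x)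
      = (\<lambda>x. \<Sum>a\<in>Basis. partial_deriv b (partial_deriv a (partial_deriv a f)) x)"
    by (rule partial_deriv_sum) (intro smooth_partial_deriv assms)
  moreover have "partial_deriv b (partial_deriv a (partial_deriv a f))
      = partial_deriv a (partial_deriv a (partial_deriv b f))" if "a \<in> Basis" for a
    using partial_deriv_commute[OF smooth_partial_deriv[OF assms(1) that] assms(2) that]
      partial_deriv_commute[OF assms(1,2) that] by simp
  ultimately show ?thesis by (auto simp: laplacian_def)
qed

lemma laplacian_test_functions:
  assumes "\<phi> \<in> test_functions \<Omega>"
  shows "laplacian \<phi> \<in> test_functions \<Omega>"
proof -
  have "laplacian \<phi> = (\<lambda>x. \<Sum>a\<in>Basis. partial_deriv a (partial_deriv a \<phi>) x)"
    by (auto simp: laplacian_def)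
  then show ?thesis
    using assms by (auto intro!: test_functions_sum test_functions_partial_deriv)
qed

lemma laplacian_funpow_test_functions:
  "\<phi> \<in> test_functions \<Omega> \<Longrightarrow> (laplacian ^^ k) \<phi> \<in> test_functions \<Omega>"
  by (induction k) (auto intro: laplacian_test_functions)

lemma partial_deriv_laplacian_funpow:
  assumes "\<phi> \<in> test_functions \<Omega>" "b \<in> Basis"
  shows "partial_deriv b ((laplacian ^^ k) \<phi>) = (laplacian ^^ k) (partial_deriv b \<phi>)"
proof (induction k)
  case (Suc k)
  have "smooth ((laplacian ^^ k) \<phi>)"
    using laplacian_funpow_test_functions[OF assms(1)] test_functions_smooth by blast
  with Suc assms(2) show ?case by (simp add: partial_deriv_laplacian)
qed simp

text \<open>
  \<open>wform w k \<phi> \<psi>\<close> is the integral of \<open>w D\<^sup>k\<phi> \<bullet> D\<^sup>k\<psi>\<close>, with \<open>D\<^sup>k\<close> the full tensor of \<open>k\<close>-th order derivatives.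
\<close>

primrec wform ::
    "('a::euclidean_space \<Rightarrow> real) \<Rightarrow> nat \<Rightarrow> ('a \<Rightarrow> real) \<Rightarrow> ('a \<Rightarrow> real) \<Rightarrow> real" where
  "wform w 0 \<phi> \<psi> = (LINT x|lebesgue. w x * (\<phi> x * \<psi> x))"
| "wform w (Suc k) \<phi> \<psi> = (\<Sum>b\<in>Basis. wform w k (partial_deriv b \<phi>) (partial_deriv b \<psi>))"

lemma wform_integrable:
  assumes "smooth w" "\<phi> \<in> test_functions UNIV" "\<psi> \<in> test_functions UNIV"
  shows "integrable lebesgue (\<lambda>x. w x * (\<phi> x * \<psi> x))"
  by (intro test_functions_integrable test_functions_mult(1) assms test_functions_smooth[OF assms(2)])

lemma wform_sym: "wform w k \<phi> \<psi> = wform w k \<psi> \<phi>"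
  by (induction k arbitrary: \<phi> \<psi>) (auto simp: mult.commute intro: sum.cong)

lemma wform_add_left:
  assumes "smooth w"
  shows "\<phi> \<in> test_functions UNIV \<Longrightarrow> \<phi>' \<in> test_functions UNIV \<Longrightarrow> \<psi> \<in> test_functions UNIV \<Longrightarrow>
    wform w k (\<lambda>x. \<phi> x + \<phi>' x) \<psi> = wform w k \<phi> \<psi> + wform w k \<phi>' \<psi>"
proof (induction k arbitrary: \<phi> \<phi>' \<psi>)
  case 0
  then show ?case
    using wform_integrable[OF assms, of \<phi> \<psi>] wform_integrable[OF assms, of \<phi>' \<psi>]
    by (simp add: algebra_simps)
next
  case (Suc k)
  then show ?case
    by (simp add: partial_deriv_smooth_add test_functions_smooth test_functions_partial_deriv sum.distrib)
qed

lemma wform_cmult_left: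
  "\<phi> \<in> test_functions UNIV \<Longrightarrow> wform w k (\<lambda>x. c * \<phi> x) \<psi> = c * wform w k \<phi> \<psi>"
proof (induction k arbitrary: \<phi> \<psi>)
  case 0
  have "(LINT x|lebesgue. w x * (c * \<phi> x * \<psi> x)) = (LINT x|lebesgue. c * (w x * (\<phi> x * \<psi> x)))"
    by (simp add: algebra_simps)
  then show ?case by simp
next
  case (Suc k)
  then show ?case
    by (simp add: partial_deriv_cmult test_functions_smooth test_functions_partial_deriv sum_distrib_left)
qed

lemma wform_nonneg:
  assumes "\<And>x. w x \<ge> 0"
  shows "wform w k \<phi> \<phi> \<ge> 0"
proof (induction k arbitrary: \<phi>)
  case 0
  then show ?case using assms by (auto intro!: integral_nonneg_AE AE_I2)
qed (auto intro: sum_nonneg)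

lemma wform_add_add:
  assumes "smooth w" "\<phi> \<in> test_functions UNIV" "\<psi> \<in> test_functions UNIV"
  shows "wform w k (\<lambda>x. \<phi> x + \<psi> x) (\<lambda>x. \<phi> x + \<psi> x)
    = wform w k \<phi> \<phi> + 2 * wform w k \<phi> \<psi> + wform w k \<psi> \<psi>"
proof -
  have sum: "(\<lambda>x. \<phi> x + \<psi> x) \<in> test_functions UNIV" using assms test_functions_add by blast
  show ?thesis
    using wform_add_left[OF assms sum, of k] wform_add_left[OF assms assms(2), of k]
      wform_add_left[OF assms assms(3), of k]
      wform_sym[of w k \<phi> "\<lambda>x. \<phi> x + \<psi> x"] wform_sym[of w k \<psi> "\<lambda>x. \<phi> x + \<psi> x"]
      wform_sym[of w k \<phi> \<psi>] by simp
qed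

lemma wform_cmult_cmult:
  assumes "\<phi> \<in> test_functions UNIV"
  shows "wform w k (\<lambda>x. c * \<phi> x) (\<lambda>x. c * \<phi> x) = c\<^sup>2 * wform w k \<phi> \<phi>"
  using wform_cmult_left[OF assms, of w k c] wform_sym[of w k \<phi> "\<lambda>x. c * \<phi> x"]
  by (simp add: power2_eq_square)

lemma wform_Cauchy_Schwarz:
  assumes "smooth w" "\<And>x. w x \<ge> 0" "\<phi> \<in> test_functions UNIV" "\<psi> \<in> test_functions UNIV"
  shows "(wform w k \<phi> \<psi>)\<^sup>2 \<le> wform w k \<phi> \<phi> * wform w k \<psi> \<psi>"
proof -
  let ?a = "wform w k \<phi> \<phi>" and ?b = "wform w k \<phi> \<psi>" and ?c = "wform w k \<psi> \<psi>"
  have quad: "?a + 2 * t * ?b + t\<^sup>2 * ?c \<ge> 0" for t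
  proof -
    have t: "(\<lambda>x. t * \<psi> x) \<in> test_functions UNIV" using assms(4) test_functions_cmult by blast
    have "0 \<le> wform w k (\<lambda>x. \<phi> x + t * \<psi> x) (\<lambda>x. \<phi> x + t * \<psi> x)"
      by (rule wform_nonneg[OF assms(2)])
    also have "\<dots> = ?a + 2 * wform w k \<phi> (\<lambda>x. t * \<psi> x) + t\<^sup>2 * ?c"
      by (simp add: wform_add_add[OF assms(1,3) t] wform_cmult_cmult[OF assms(4)])
    also have "wform w k \<phi> (\<lambda>x. t * \<psi> x) = t * ?b"
      using wform_cmult_left[OF assms(4), of w k t \<phi>]
        wform_sym[of w k \<phi> "\<lambda>x. t * \<psi> x"] wform_sym[of w k \<phi> \<psi>] by simp
    finally show ?thesis by simp
  qed
  have c: "?c \<ge> 0" by (rule wform_nonneg[OF assms(2)])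
  show ?thesis
  proof (cases "?c = 0")
    case True
    have "?b = 0"
    proof (rule ccontr)
      assume "?b \<noteq> 0"
      \<comment> \<open>With vanishing leading coefficient the quadratic is affine in t; this t
        gives it the value -1.\<close>
      with quad[of "- (?a + 1) / (2 * ?b)"] True show False by (simp add: field_simps)
    qed
    then show ?thesis using True by simp
  next
    case False
    then have "?c > 0" using c by simp
    \<comment> \<open>The quadratic is evaluated at its minimiser and multiplied by its leading
      coefficient, which yields the discriminant.\<close>
    have "0 \<le> ?c * (?a + 2 * (- ?b / ?c) * ?b + (- ?b / ?c)\<^sup>2 * ?c)"
      by (rule mult_nonneg_nonneg[OF c quad])
    also have "\<dots> = ?a * ?c - ?b\<^sup>2"
      using False by (simp add: field_simps power2_eq_square)
    finally show ?thesis by simp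
  qed
qed

lemma wform_triangle:
  assumes "smooth w" "\<And>x. w x \<ge> 0" "\<phi> \<in> test_functions UNIV" "\<psi> \<in> test_functions UNIV"
  shows "sqrt (wform w k (\<lambda>x. \<phi> x + \<psi> x) (\<lambda>x. \<phi> x + \<psi> x)) \<le> sqrt (wform w k \<phi> \<phi>) + sqrt (wform w k \<psi> \<psi>)"
proof -
  have nonneg: "wform w k u u \<ge> 0" for u
    by (rule wform_nonneg) (rule assms(2))
  have "wform w k \<phi> \<psi> \<le> sqrt (wform w k \<phi> \<phi>) * sqrt (wform w k \<psi> \<psi>)"
    using real_le_rsqrt[OF wform_Cauchy_Schwarz[OF assms, of k]] by (simp add: real_sqrt_mult)
  then have "wform w k (\<lambda>x. \<phi> x + \<psi> x) (\<lambda>x. \<phi> x + \<psi> x) \<le> (sqrt (wform w k \<phi> \<phi>) + sqrt (wform w k \<psi> \<psi>))\<^sup>2"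
    using nonneg by (simp add: wform_add_add[OF assms(1,3,4)] power2_sum)
  then show ?thesis
    using nonneg by (intro real_le_lsqrt) auto
qed

text \<open>Each derivative moved from \<phi> to \<psi> costs a sign and meets its twin there;
  summed over the directions, each pair is one Laplacian. Commuting Laplacians with partial
  derivatives lets the induction continue.\<close>

lemma wform_eq_laplacian:
  "\<phi> \<in> test_functions UNIV \<Longrightarrow> \<psi> \<in> test_functions UNIV \<Longrightarrow>
    wform (\<lambda>_. 1) k \<phi> \<psi> = (-1) ^ k * (LINT x|lebesgue. \<phi> x * (laplacian ^^ k) \<psi> x)"
proof (induction k arbitrary: \<phi> \<psi>)
  case (Suc k)
  let ?L = "(laplacian ^^ k) \<psi>"
  have L: "?L \<in> test_functions UNIV" using Suc.prems laplacian_funpow_test_functions by blast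
  have "wform (\<lambda>_. 1) (Suc k) \<phi> \<psi>
      = (\<Sum>b\<in>Basis. (-1) ^ k * (LINT x|lebesgue. partial_deriv b \<phi> x * partial_deriv b ?L x))"
    by (simp add: Suc.IH Suc.prems test_functions_partial_deriv
        partial_deriv_laplacian_funpow[OF Suc.prems(2)])
  also have "\<dots> = (\<Sum>b\<in>Basis. (-1) ^ Suc k *
      (LINT x|lebesgue. \<phi> x * partial_deriv b (partial_deriv b ?L) x))"
    by (intro sum.cong refl)
      (simp add: integral_by_parts Suc.prems smooth_partial_deriv test_functions_smooth[OF L])
  also have "\<dots> = (-1) ^ Suc k *
      (LINT x|lebesgue. (\<Sum>b\<in>Basis. \<phi> x * partial_deriv b (partial_deriv b ?L) x))"
  proof -
    have "integrable lebesgue (\<lambda>x. \<phi> x * partial_deriv b (partial_deriv b ?L) x)" if "b \<in> Basis" for b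
      by (intro test_functions_integrable test_functions_mult(2) Suc.prems smooth_partial_deriv
          test_functions_smooth[OF L] that)
    then show ?thesis by (simp add: sum_distrib_left)
  qed
  also have "\<dots> = (-1) ^ Suc k * (LINT x|lebesgue. \<phi> x * laplacian ?L x)"
    by (simp add: laplacian_def sum_distrib_left)
  finally show ?case by simp
qed simp

text \<open>Self-adjointness is inherited from the symmetry of \<open>wform\<close>: both sides are
  the same form up to the same sign.\<close>

lemma integral_laplacian_funpow_sym:
  assumes "\<phi> \<in> test_functions UNIV" "\<psi> \<in> test_functions UNIV"
  shows "(LINT x|lebesgue. (laplacian ^^ k) \<phi> x * \<psi> x) = (LINT x|lebesgue. \<phi> x * (laplacian ^^ k) \<psi> x)"
proof -
  have "(LINT x|lebesgue. (laplacian ^^ k) \<phi> x * \<psi> x) = (LINT x|lebesgue. \<psi> x * (laplacian ^^ k) \<phi> x)"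
    by (simp add: mult.commute)
  then show ?thesis
    using wform_eq_laplacian[OF assms, of k] wform_eq_laplacian[OF assms(2,1), of k]
      wform_sym[of "\<lambda>_. 1" k \<phi> \<psi>] by simp
qed

lemma norm_gradient_squared: "(norm (gradient f x))\<^sup>2 = (\<Sum>b\<in>Basis. (partial_deriv b f x)\<^sup>2)"
proof -
  have "gradient f x \<bullet> b = partial_deriv b f x" if "b \<in> Basis" for b
    unfolding gradient_def using that by simp
  then show ?thesis
    unfolding power2_norm_eq_inner by (subst euclidean_inner) (simp add: power2_eq_square)
qed

text \<open>Both sides equal (-1)^m times the integral of \<phi> against its m-th iterated
  Laplacian. The passage to the full derivative tensor is what makes a Leibniz induction, a
  Cauchy-Schwarz inequality and Hardy estimates order by order available for the energy.\<close>

lemma test_energy_eq_wform: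
  assumes "\<phi> \<in> test_functions UNIV"
  shows "test_energy m \<phi> = wform (\<lambda>_. 1) m \<phi> \<phi>"
proof -
  define j where "j = m div 2"
  let ?L = "(laplacian ^^ j) \<phi>"
  have L: "?L \<in> test_functions UNIV" using assms laplacian_funpow_test_functions by blast
  show ?thesis
  proof (cases "even m")
    case True
    then have m: "m = j + j" by (auto simp: j_def)
    have "test_energy m \<phi> = (LINT x|lebesgue. ?L x * ?L x)"
      using True by (simp add: test_energy_def norm_nabla_def j_def power2_eq_square)
    also have "\<dots> = (LINT x|lebesgue. \<phi> x * (laplacian ^^ j) ?L x)"
      by (rule integral_laplacian_funpow_sym[OF assms L])
    also have "\<dots> = wform (\<lambda>_. 1) m \<phi> \<phi>"
      using True by (simp only: wform_eq_laplacian[OF assms assms]) (simp add: m funpow_add)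
    finally show ?thesis .
  next
    case False
    then have m: "m = j + Suc j" "(m - 1) div 2 = j" by (auto simp: j_def elim: oddE)
    have "test_energy m \<phi> = (LINT x|lebesgue. (\<Sum>b\<in>Basis. (partial_deriv b ?L x)\<^sup>2))"
      unfolding test_energy_def norm_nabla_def m(2) norm_gradient_squared if_not_P[OF False] ..
    also have "\<dots> = wform (\<lambda>_. 1) (Suc 0) ?L ?L"
    proof -
      have "integrable lebesgue (\<lambda>x. (partial_deriv b ?L x)\<^sup>2)" if "b \<in> Basis" for b
        using wform_integrable[of "\<lambda>_. 1" "partial_deriv b ?L" "partial_deriv b ?L"]
          test_functions_partial_deriv[OF L that] by (simp add: power2_eq_square)
      then show ?thesis by (simp add: power2_eq_square)
    qed
    \<comment> \<open>For odd m the one gradient on each side becomes a Laplacian at the price of a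
      minus sign, which is (-1)^m.\<close>
    also have "\<dots> = - (LINT x|lebesgue. ?L x * laplacian ?L x)"
      using wform_eq_laplacian[OF L L, of "Suc 0"] by simp
    also have "(LINT x|lebesgue. ?L x * laplacian ?L x)
        = (LINT x|lebesgue. \<phi> x * (laplacian ^^ j) (laplacian ?L) x)"
      by (rule integral_laplacian_funpow_sym[OF assms laplacian_test_functions[OF L]])
    also have "(laplacian ^^ j) (laplacian ?L) = (laplacian ^^ m) \<phi>"
      by (simp only: m(1) funpow_add funpow.simps o_apply)
    finally show ?thesis
      using False by (simp add: wform_eq_laplacian[OF assms assms])
  qed
qed

section \<open>Hardy inequality and multiplication by test functions\<close>

text \<open>A regularised form of the Hardy weight |x|^(-2s): it has the same decay at infinity, but
  is smooth and positive at the origin, so the integration by parts needs no excision there.\<close>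

definition hweight :: "nat \<Rightarrow> 'a::euclidean_space \<Rightarrow> real" where
  "hweight s x = inverse (1 + x \<bullet> x) ^ s"

lemma one_plus_inner_pos: "1 + (x::'a::real_inner) \<bullet> x > 0"
  using inner_ge_zero[of x] by linarith

lemma hweight_pos: "hweight s x > 0"
  unfolding hweight_def using one_plus_inner_pos[of x] by simp

lemma hweight_0: "hweight 0 = (\<lambda>_. 1)"
  by (auto simp: hweight_def)

lemma hweight_antimono:
  assumes "s \<le> t"
  shows "hweight t x \<le> hweight s x"
  unfolding hweight_def
proof (rule power_decreasing[OF assms])
  show "0 \<le> inverse (1 + x \<bullet> x)" using one_plus_inner_pos[of x] by simp
  show "inverse (1 + x \<bullet> x) \<le> 1" using inner_ge_zero[of x] by (intro inverse_le_1_iff[THEN iffD2]) simp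
qed

lemma smooth_hweight: "smooth (hweight s :: 'a::euclidean_space \<Rightarrow> real)"
proof -
  have "smooth (\<lambda>x::'a. inverse (1 + x \<bullet> x) ^ s)"
    by (intro smooth_power smooth_inverse smooth_add smooth_const smooth_inner_self)
       (rule less_imp_neq[THEN not_sym, OF one_plus_inner_pos])
  then show ?thesis unfolding hweight_def[abs_def] .
qed

lemma partial_deriv_inner_self: "partial_deriv b (\<lambda>x. x \<bullet> x) x = 2 * (x \<bullet> b)"
  using partial_deriv_eq[OF has_derivative_inner[OF has_derivative_ident has_derivative_ident], of b x]
  by (simp add: inner_commute)

lemma partial_deriv_hweight:
  "partial_deriv b (hweight s) x = - 2 * real s * (x \<bullet> b) * hweight (Suc s) x"
proof (cases s)
  case (Suc k)
  let ?i = "inverse (1 + x \<bullet> x)"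
  have "((\<lambda>t. inverse (1 + t) ^ s) has_real_derivative - real s * ?i ^ Suc s) (at (x \<bullet> x))"
    by (rule derivative_eq_intros refl | use one_plus_inner_pos[of x] in force)+
       (simp add: Suc power2_eq_square algebra_simps)
  from partial_deriv_compose[OF smooth_differentiable[OF smooth_inner_self] this, of b]
  show ?thesis
    by (simp add: hweight_def[abs_def] partial_deriv_inner_self)
qed (simp add: hweight_0)


text \<open>
  The weighted Hardy inequality comes from the divergence theorem for the vector fields \<open>u\<^sup>2 x (1+|x|\<^sup>2)\<^sup>-\<^sup>s\<close>,
  since \<open>div (x (1+|x|\<^sup>2)\<^sup>-\<^sup>s) \<ge> (N - 2s) (1+|x|\<^sup>2)\<^sup>-\<^sup>s\<close>.
\<close>

lemma hardy_weighted_0: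
  fixes u :: "'a::euclidean_space \<Rightarrow> real"
  assumes N: "2 * Suc k < DIM('a)" and u: "u \<in> test_functions UNIV"
  defines "c \<equiv> real DIM('a) - 2 * real (Suc k)"
  shows "wform (hweight (Suc k)) 0 u u \<le> 4 / c\<^sup>2 * wform (hweight k) (Suc 0) u u"
proof -
  have c: "c > 0" using N by (simp add: c_def)
  define v where "v b x = (x \<bullet> b) * hweight (Suc k) x" for b x :: 'a
  define G where "G b x = (u x * u x) * v b x" for b x
  have su: "smooth u" using u test_functions_smooth by blast
  have sv: "smooth (v b)" for b
    unfolding v_def[abs_def] by (intro smooth_mult smooth_inner smooth_hweight)
  have G: "G b \<in> test_functions UNIV" for b
    unfolding G_def[abs_def] by (intro test_functions_mult(2) u su sv)
  have dv: "partial_deriv b (v b) x = hweight (Suc k) x - 2 * real (Suc k) * (x \<bullet> b)\<^sup>2 * hweight (Suc (Suc k)) x"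
    if "b \<in> Basis" for b x
  proof -
    have "partial_deriv b (v b) x = partial_deriv b (\<lambda>x. x \<bullet> b) x * hweight (Suc k) x
        + (x \<bullet> b) * partial_deriv b (hweight (Suc k)) x"
      unfolding v_def[abs_def] by (simp add: partial_deriv_smooth_mult smooth_inner smooth_hweight)
    then show ?thesis
      using that by (simp add: partial_deriv_inner partial_deriv_hweight power2_eq_square algebra_simps)
  qed
  have dG: "partial_deriv b (G b) x = 2 * u x * partial_deriv b u x * v b x + (u x)\<^sup>2 * partial_deriv b (v b) x" for b x
    unfolding G_def[abs_def]
    by (simp add: partial_deriv_smooth_mult su sv smooth_mult power2_eq_square algebra_simps)
  \<comment> \<open>Integration turns this into the claim, since the divergence terms integrate to
    zero. Half of the lower bound \<open>c\<close> for the divergence stays on the left; the other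
    half absorbs the cross term produced by differentiating u^2.\<close>
  have pointwise: "c / 2 * (hweight (Suc k) x * (u x * u x))
      \<le> (\<Sum>b\<in>Basis. partial_deriv b (G b) x + 2 / c * (hweight k x * (partial_deriv b u x * partial_deriv b u x)))" for x
  proof -
    define i where "i = inverse (1 + x \<bullet> x)"
    define p where "p = i ^ k"
    have i: "i > 0" "i * (1 + x \<bullet> x) = 1"
      unfolding i_def using one_plus_inner_pos[of x] by simp_all
    have p: "p \<ge> 0" unfolding p_def using i by simp
    have w: "hweight k x = p" "hweight (Suc k) x = i * p" "hweight (Suc (Suc k)) x = i * i * p"
      by (simp_all add: hweight_def i_def p_def)
    have b: "(u x)\<^sup>2 * (i * p) - (2 * real (Suc k) + c / 2) * ((u x)\<^sup>2 * (i * i * p)) * (x \<bullet> b)\<^sup>2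
        \<le> partial_deriv b (G b) x + 2 / c * (hweight k x * (partial_deriv b u x * partial_deriv b u x))"
      if "b \<in> Basis" for b
    proof -
      let ?B = "partial_deriv b u x"
      \<comment> \<open>The coefficients are chosen so that the mixed term of this square is exactly
        the cross term in the derivative of \<open>G b\<close>.\<close>
      have "0 \<le> p * (c / 2) * (u x * (x \<bullet> b) * i + (2 / c) * ?B)\<^sup>2"
        using p c by simp
      also have "\<dots> = (c / 2) * ((u x)\<^sup>2 * (i * i * p)) * (x \<bullet> b)\<^sup>2
          + 2 * u x * ?B * ((x \<bullet> b) * (i * p)) + 2 / c * (p * (?B * ?B))"
        using c by (simp add: power2_eq_square field_simps)
      finally show ?thesis
        unfolding dG dv[OF that] w v_def by (simp add: algebra_simps)
    qed
    have "(\<Sum>b\<in>Basis. (x \<bullet> b)\<^sup>2) = x \<bullet> x"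
      by (subst (2) euclidean_inner) (simp add: power2_eq_square)
    then have "(\<Sum>b\<in>Basis. (u x)\<^sup>2 * (i * p) - (2 * real (Suc k) + c / 2) * ((u x)\<^sup>2 * (i * i * p)) * (x \<bullet> b)\<^sup>2)
        = real DIM('a) * ((u x)\<^sup>2 * (i * p)) - (2 * real (Suc k) + c / 2) * ((u x)\<^sup>2 * (i * i * p)) * (x \<bullet> x)"
      by (simp add: sum_subtractf sum_distrib_left[symmetric])
    \<comment> \<open>Here |x|^2 / (1 + |x|^2) \<le> 1 removes one factor \<open>i\<close>. The
      remaining coefficient is N - 2(k + 1) - c/2 = c/2.\<close>
    moreover have "(2 * real (Suc k) + c / 2) * ((u x)\<^sup>2 * (i * i * p)) * (x \<bullet> x)
        \<le> (2 * real (Suc k) + c / 2) * ((u x)\<^sup>2 * (i * p))"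
    proof -
      have "i * (x \<bullet> x) \<le> 1" using i by (simp add: algebra_simps)
      then have "((2 * real (Suc k) + c / 2) * ((u x)\<^sup>2 * (i * p))) * (i * (x \<bullet> x))
          \<le> ((2 * real (Suc k) + c / 2) * ((u x)\<^sup>2 * (i * p))) * 1"
        using c i p by (intro mult_left_mono mult_nonneg_nonneg add_nonneg_nonneg) auto
      then show ?thesis by (simp only: mult.assoc mult.commute mult.left_commute mult_1_right)
    qed
    moreover have "real DIM('a) * ((u x)\<^sup>2 * (i * p)) - (2 * real (Suc k) + c / 2) * ((u x)\<^sup>2 * (i * p))
        = c / 2 * (hweight (Suc k) x * (u x * u x))"
      unfolding w c_def by (simp add: power2_eq_square field_simps)
    ultimately have "c / 2 * (hweight (Suc k) x * (u x * u x))
        \<le> (\<Sum>b\<in>Basis. (u x)\<^sup>2 * (i * p) - (2 * real (Suc k) + c / 2) * ((u x)\<^sup>2 * (i * i * p)) * (x \<bullet> b)\<^sup>2)"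
      by linarith
    also have "\<dots> \<le> (\<Sum>b\<in>Basis. partial_deriv b (G b) x + 2 / c * (hweight k x * (partial_deriv b u x * partial_deriv b u x)))"
      by (rule sum_mono) (rule b)
    finally show ?thesis .
  qed
  have int_G: "integrable lebesgue (partial_deriv b (G b))" if "b \<in> Basis" for b
    by (intro test_functions_integrable test_functions_partial_deriv G that)
  have int_u: "integrable lebesgue (\<lambda>x. hweight k x * (partial_deriv b u x * partial_deriv b u x))"
    if "b \<in> Basis" for b
    by (intro wform_integrable smooth_hweight test_functions_partial_deriv u that)
  have "c / 2 * wform (hweight (Suc k)) 0 u u = (LINT x|lebesgue. c / 2 * (hweight (Suc k) x * (u x * u x)))"
    by simp
  also have "\<dots> \<le> (LINT x|lebesgue. (\<Sum>b\<in>Basis. partial_deriv b (G b) x +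
      2 / c * (hweight k x * (partial_deriv b u x * partial_deriv b u x))))"
    by (intro integral_mono integrable_mult_right wform_integrable smooth_hweight u
        Bochner_Integration.integrable_sum Bochner_Integration.integrable_add int_G int_u pointwise)
  also have "\<dots> = (\<Sum>b\<in>Basis. (LINT x|lebesgue. partial_deriv b (G b) x) +
      2 / c * (LINT x|lebesgue. hweight k x * (partial_deriv b u x * partial_deriv b u x)))"
    using int_G int_u by simp
  also have "\<dots> = 2 / c * wform (hweight k) (Suc 0) u u"
    by (simp add: integral_partial_deriv G sum_distrib_left)
  finally have "2 / c * (c / 2 * wform (hweight (Suc k)) 0 u u) \<le> 2 / c * (2 / c * wform (hweight k) (Suc 0) u u)"
    using c by (intro mult_left_mono) auto
  then show ?thesis using c by (simp add: power2_eq_square)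
qed

lemma hardy_weighted:
  fixes u :: "'a::euclidean_space \<Rightarrow> real"
  assumes "2 * Suc k < DIM('a)" "u \<in> test_functions UNIV"
  shows "wform (hweight (Suc k)) j u u
    \<le> 4 / (real DIM('a) - 2 * real (Suc k))\<^sup>2 * wform (hweight k) (Suc j) u u"
  using assms(2)
proof (induction j arbitrary: u)
  case 0
  then show ?case by (rule hardy_weighted_0[OF assms(1)])
next
  case (Suc j)
  then show ?case
    unfolding wform.simps(2)[of _ "Suc j"] wform.simps(2)[of "hweight (Suc k)" j] sum_distrib_left
    by (intro sum_mono) (use test_functions_partial_deriv in blast)
qed

text \<open>Hardy's inequality trades one power of the weight for one derivative; iterating it uses
  up all \<open>j\<close> powers. The condition \<open>2 * j < DIM('a)\<close> makes every
  inequality in this chain applicable, the one for the largest exponent being the most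
  demanding.\<close>

lemma wform_hweight_le:
  assumes "2 * j < DIM('a)"
  shows "\<exists>C\<ge>0. \<forall>u::'a::euclidean_space \<Rightarrow> real. u \<in> test_functions UNIV \<longrightarrow>
    wform (hweight j) i u u \<le> C * wform (\<lambda>_. 1) (j + i) u u"
  using assms
proof (induction j arbitrary: i)
  case 0
  then show ?case by (intro exI[of _ 1]) (simp add: hweight_0)
next
  case (Suc j)
  obtain C where C: "C \<ge> 0" "\<forall>u::'a \<Rightarrow> real. u \<in> test_functions UNIV \<longrightarrow>
      wform (hweight j) (Suc i) u u \<le> C * wform (\<lambda>_. 1) (j + Suc i) u u"
    using Suc.IH[of "Suc i"] Suc.prems by auto
  let ?D = "4 / (real DIM('a) - 2 * real (Suc j))\<^sup>2"
  have "wform (hweight (Suc j)) i u u \<le> (?D * C) * wform (\<lambda>_. 1) (Suc j + i) u u"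
    if u: "u \<in> test_functions UNIV" for u :: "'a \<Rightarrow> real"
  proof -
    have "wform (hweight (Suc j)) i u u \<le> ?D * wform (hweight j) (Suc i) u u"
      by (rule hardy_weighted[OF Suc.prems u])
    also have "\<dots> \<le> ?D * (C * wform (\<lambda>_. 1) (j + Suc i) u u)"
      using C(2) u by (intro mult_left_mono) auto
    finally show ?thesis by (simp add: mult.assoc)
  qed
  moreover have "?D * C \<ge> 0" using C(1) by simp
  ultimately show ?case by blast
qed

section \<open>Leibniz estimates and boundedness of multiplication by a test function\<close>

lemma wform_weight_mono:
  assumes "smooth w" "smooth w'" "\<And>x. w x \<le> w' x" "\<phi> \<in> test_functions UNIV"
  shows "wform w k \<phi> \<phi> \<le> wform w' k \<phi> \<phi>"
  using assms(4)
proof (induction k arbitrary: \<phi>)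
  case 0
  then show ?case
    unfolding wform.simps(1)
    by (intro integral_mono wform_integrable assms(1,2) mult_right_mono assms(3)) auto
next
  case (Suc k)
  then show ?case
    unfolding wform.simps(2) by (intro sum_mono Suc.IH test_functions_partial_deriv)
qed

text \<open>The parallelogram identity with the energy of the difference dropped. A bound for
  squares is more convenient than the triangle inequality when it has to be summed over
  directions.\<close>

lemma wform_add_le:
  assumes "smooth w" "\<And>x. w x \<ge> 0" "\<phi> \<in> test_functions UNIV" "\<psi> \<in> test_functions UNIV"
  shows "wform w k (\<lambda>x. \<phi> x + \<psi> x) (\<lambda>x. \<phi> x + \<psi> x) \<le> 2 * (wform w k \<phi> \<phi> + wform w k \<psi> \<psi>)"
proof -
  have m: "(\<lambda>x. (-1) * \<psi> x) \<in> test_functions UNIV" by (rule test_functions_cmult[OF assms(4)])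
  have "0 \<le> wform w k (\<lambda>x. \<phi> x + (-1) * \<psi> x) (\<lambda>x. \<phi> x + (-1) * \<psi> x)"
    by (rule wform_nonneg[OF assms(2)])
  also have "\<dots> = wform w k \<phi> \<phi> + 2 * wform w k \<phi> (\<lambda>x. (-1) * \<psi> x) + wform w k \<psi> \<psi>"
    by (simp only: wform_add_add[OF assms(1,3) m] wform_cmult_cmult[OF assms(4)]) simp
  also have "wform w k \<phi> (\<lambda>x. (-1) * \<psi> x) = - wform w k \<phi> \<psi>"
    using wform_cmult_left[OF assms(4), of w k "-1" \<phi>]
      wform_sym[of w k \<phi> "\<lambda>x. (-1) * \<psi> x"] wform_sym[of w k \<phi> \<psi>] by linarith
  finally show ?thesis unfolding wform_add_add[OF assms(1,3,4)] by (simp add: distrib_left)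
qed

text \<open>Differentiating h\<psi> once leaves two products of lower order, one with a derivative
  of h and one with a derivative of \<psi>; the induction hypothesis must therefore hold for all
  test functions \<open>h\<close>. The constant depends on \<open>h\<close>, \<open>w\<close> and
  \<open>k\<close> only. Every positive smooth weight is allowed, because compact support of
  \<open>h\<close> confines the comparison of 1 with \<open>w\<close> to a bounded set.\<close>

lemma wform_mult_bound:
  fixes h :: "'a::euclidean_space \<Rightarrow> real"
  assumes w: "smooth w" "\<And>x. w x > 0"
  shows "h \<in> test_functions UNIV \<Longrightarrow> \<exists>C\<ge>0. \<forall>\<psi>. \<psi> \<in> test_functions UNIV \<longrightarrow>
    wform (\<lambda>_. 1) k (\<lambda>x. h x * \<psi> x) (\<lambda>x. h x * \<psi> x) \<le> C * (\<Sum>i\<le>k. wform w i \<psi> \<psi>)"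
proof (induction k arbitrary: h)
  case 0
  have sh: "smooth h" using 0 test_functions_smooth by blast
  have "smooth (\<lambda>x. inverse (w x))"
    by (rule smooth_inverse[OF w(1)]) (rule less_imp_neq[THEN not_sym, OF w(2)])
  \<comment> \<open>The quotient h^2/w is itself a test function, so its supremum bounds h^2 by a
    multiple of the weight.\<close>
  then have "(\<lambda>x. (h x * h x) * inverse (w x)) \<in> test_functions UNIV"
    by (intro test_functions_mult(2) 0 sh)
  from test_functions_bound[OF this] obtain C where
    C: "C > 0" "\<forall>x. \<bar>(h x * h x) * inverse (w x)\<bar> \<le> C" by blast
  have h: "h x * h x \<le> C * w x" for x
  proof -
    have "(h x * h x) * inverse (w x) \<le> C" using C(2) abs_le_D1 by blast
    then show ?thesis using w(2)[of x] by (simp add: field_simps)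
  qed
  have "wform (\<lambda>_. 1) 0 (\<lambda>x. h x * \<psi> x) (\<lambda>x. h x * \<psi> x) \<le> C * (\<Sum>i\<le>0. wform w i \<psi> \<psi>)"
    if \<psi>: "\<psi> \<in> test_functions UNIV" for \<psi>
  proof -
    have "wform (\<lambda>_. 1) 0 (\<lambda>x. h x * \<psi> x) (\<lambda>x. h x * \<psi> x)
        = (LINT x|lebesgue. (h x * h x) * (\<psi> x * \<psi> x))"
      by (simp add: mult.assoc mult.left_commute)
    also have "\<dots> \<le> (LINT x|lebesgue. (C * w x) * (\<psi> x * \<psi> x))"
      by (intro integral_mono wform_integrable \<psi> mult_right_mono h smooth_mult sh smooth_const w(1)) auto
    also have "\<dots> = C * (\<Sum>i\<le>0. wform w i \<psi> \<psi>)"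
      by (simp add: mult.assoc)
    finally show ?thesis .
  qed
  then show ?case using C(1) less_imp_le by blast
next
  case (Suc k)
  have sh: "smooth h" using Suc.prems test_functions_smooth by blast
  obtain C where C: "C \<ge> 0" "\<forall>\<psi>. \<psi> \<in> test_functions UNIV \<longrightarrow>
      wform (\<lambda>_. 1) k (\<lambda>x. h x * \<psi> x) (\<lambda>x. h x * \<psi> x) \<le> C * (\<Sum>i\<le>k. wform w i \<psi> \<psi>)"
    using Suc.IH[OF Suc.prems] by blast
  have "\<forall>b\<in>Basis. \<exists>D\<ge>0. \<forall>\<psi>. \<psi> \<in> test_functions UNIV \<longrightarrow>
      wform (\<lambda>_. 1) k (\<lambda>x. partial_deriv b h x * \<psi> x) (\<lambda>x. partial_deriv b h x * \<psi> x)
      \<le> D * (\<Sum>i\<le>k. wform w i \<psi> \<psi>)"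
    by (intro ballI Suc.IH test_functions_partial_deriv Suc.prems)
  from bchoice[OF this] obtain D where D: "\<forall>b\<in>Basis. D b \<ge> 0 \<and> (\<forall>\<psi>. \<psi> \<in> test_functions UNIV \<longrightarrow>
      wform (\<lambda>_. 1) k (\<lambda>x. partial_deriv b h x * \<psi> x) (\<lambda>x. partial_deriv b h x * \<psi> x)
      \<le> D b * (\<Sum>i\<le>k. wform w i \<psi> \<psi>))" ..
  have "wform (\<lambda>_. 1) (Suc k) (\<lambda>x. h x * \<psi> x) (\<lambda>x. h x * \<psi> x)
      \<le> 2 * ((\<Sum>b\<in>Basis. D b) + C) * (\<Sum>i\<le>Suc k. wform w i \<psi> \<psi>)"
    if \<psi>: "\<psi> \<in> test_functions UNIV" for \<psi>
  proof -
    have s\<psi>: "smooth \<psi>" using \<psi> test_functions_smooth by blast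
    let ?S = "\<Sum>i\<le>Suc k. wform w i \<psi> \<psi>"
    have nn: "wform w i \<phi> \<phi> \<ge> 0" for i \<phi>
      by (rule wform_nonneg) (rule less_imp_le[OF w(2)])
    have "wform (\<lambda>_. 1) (Suc k) (\<lambda>x. h x * \<psi> x) (\<lambda>x. h x * \<psi> x)
        = (\<Sum>b\<in>Basis. wform (\<lambda>_. 1) k (\<lambda>x. partial_deriv b h x * \<psi> x + h x * partial_deriv b \<psi> x)
            (\<lambda>x. partial_deriv b h x * \<psi> x + h x * partial_deriv b \<psi> x))"
      by (simp add: partial_deriv_smooth_mult sh s\<psi>)
    also have "\<dots> \<le> (\<Sum>b\<in>Basis. 2 * (D b * (\<Sum>i\<le>k. wform w i \<psi> \<psi>)
        + C * (\<Sum>i\<le>k. wform w i (partial_deriv b \<psi>) (partial_deriv b \<psi>))))"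
    proof (rule sum_mono)
      fix b :: 'a assume b: "b \<in> Basis"
      have d: "partial_deriv b \<psi> \<in> test_functions UNIV" by (rule test_functions_partial_deriv[OF \<psi> b])
      have "wform (\<lambda>_. 1) k (\<lambda>x. partial_deriv b h x * \<psi> x + h x * partial_deriv b \<psi> x)
            (\<lambda>x. partial_deriv b h x * \<psi> x + h x * partial_deriv b \<psi> x)
          \<le> 2 * (wform (\<lambda>_. 1) k (\<lambda>x. partial_deriv b h x * \<psi> x) (\<lambda>x. partial_deriv b h x * \<psi> x)
            + wform (\<lambda>_. 1) k (\<lambda>x. h x * partial_deriv b \<psi> x) (\<lambda>x. h x * partial_deriv b \<psi> x))"
        by (rule wform_add_le)
           (simp_all add: test_functions_mult(1) \<psi> d sh smooth_partial_deriv[OF sh b])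
      then show "wform (\<lambda>_. 1) k (\<lambda>x. partial_deriv b h x * \<psi> x + h x * partial_deriv b \<psi> x)
            (\<lambda>x. partial_deriv b h x * \<psi> x + h x * partial_deriv b \<psi> x)
          \<le> 2 * (D b * (\<Sum>i\<le>k. wform w i \<psi> \<psi>)
        + C * (\<Sum>i\<le>k. wform w i (partial_deriv b \<psi>) (partial_deriv b \<psi>)))"
        using D[rule_format, OF b, THEN conjunct2, rule_format, OF \<psi>] C(2)[rule_format, OF d]
        unfolding distrib_left by linarith
    qed
    also have "\<dots> = 2 * ((\<Sum>b\<in>Basis. D b) * (\<Sum>i\<le>k. wform w i \<psi> \<psi>)
        + C * (\<Sum>b\<in>Basis. \<Sum>i\<le>k. wform w i (partial_deriv b \<psi>) (partial_deriv b \<psi>)))"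
      by (simp only: sum_distrib_left[symmetric] sum_distrib_right[symmetric] sum.distrib)
    also have "(\<Sum>b\<in>Basis. \<Sum>i\<le>k. wform w i (partial_deriv b \<psi>) (partial_deriv b \<psi>))
        = (\<Sum>i\<le>k. wform w (Suc i) \<psi> \<psi>)"
      by (subst sum.swap) simp
    also have "2 * ((\<Sum>b\<in>Basis. D b) * (\<Sum>i\<le>k. wform w i \<psi> \<psi>) + C * (\<Sum>i\<le>k. wform w (Suc i) \<psi> \<psi>))
        \<le> 2 * ((\<Sum>b\<in>Basis. D b) * ?S + C * ?S)"
    proof -
      \<comment> \<open>Both sums are the full sum with one nonnegative term missing: the top one
        here, the one of order 0 below.\<close>
      have "(\<Sum>i\<le>k. wform w i \<psi> \<psi>) \<le> ?S"
        using nn[of "Suc k" \<psi>] unfolding sum.atMost_Suc by linarith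
      moreover have "(\<Sum>i\<le>k. wform w (Suc i) \<psi> \<psi>) \<le> ?S"
        using nn[of 0 \<psi>] unfolding sum.atMost_Suc_shift by linarith
      ultimately show ?thesis
        using C(1) sum_nonneg[of Basis D] D by (intro mult_left_mono add_mono) auto
    qed
    finally show ?thesis by (simp add: algebra_simps)
  qed
  moreover have "2 * ((\<Sum>b\<in>Basis. D b) + C) \<ge> 0"
    using C(1) sum_nonneg[of Basis D] D by simp
  ultimately show ?case by blast
qed

text \<open>The Leibniz estimate leaves derivatives of \<psi> of every order i \<le> m, all carrying
  the weight \<open>hweight m\<close>. Hardy's inequality with m - i powers of the weight lifts each
  of them to order m, where the weight is 1.\<close>

lemma test_energy_mult:
  fixes h :: "'a::euclidean_space \<Rightarrow> real"
  assumes "2 * m < DIM('a)" "h \<in> test_functions UNIV"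
  shows "\<exists>C\<ge>0. \<forall>\<psi>. \<psi> \<in> test_functions UNIV \<longrightarrow> test_energy m (\<lambda>x. h x * \<psi> x) \<le> C * test_energy m \<psi>"
proof -
  obtain C where C: "C \<ge> 0" "\<forall>\<psi>. \<psi> \<in> test_functions UNIV \<longrightarrow>
      wform (\<lambda>_. 1) m (\<lambda>x. h x * \<psi> x) (\<lambda>x. h x * \<psi> x) \<le> C * (\<Sum>i\<le>m. wform (hweight m) i \<psi> \<psi>)"
    using wform_mult_bound[OF smooth_hweight hweight_pos assms(2)] by blast
  have "\<forall>i. \<exists>D\<ge>0. i \<le> m \<longrightarrow> (\<forall>\<psi>::'a \<Rightarrow> real. \<psi> \<in> test_functions UNIV \<longrightarrow>
      wform (hweight (m - i)) i \<psi> \<psi> \<le> D * wform (\<lambda>_. 1) m \<psi> \<psi>)"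
  proof
    fix i
    show "\<exists>D\<ge>0. i \<le> m \<longrightarrow> (\<forall>\<psi>::'a \<Rightarrow> real. \<psi> \<in> test_functions UNIV \<longrightarrow>
      wform (hweight (m - i)) i \<psi> \<psi> \<le> D * wform (\<lambda>_. 1) m \<psi> \<psi>)"
      using wform_hweight_le[where 'a='a, of "m - i" i] assms(1) by (cases "i \<le> m") auto
  qed
  from choice[OF this] obtain D where D: "\<forall>i. D i \<ge> 0 \<and> (i \<le> m \<longrightarrow>
      (\<forall>\<psi>::'a \<Rightarrow> real. \<psi> \<in> test_functions UNIV \<longrightarrow>
        wform (hweight (m - i)) i \<psi> \<psi> \<le> D i * wform (\<lambda>_. 1) m \<psi> \<psi>))" ..
  have "test_energy m (\<lambda>x. h x * \<psi> x) \<le> (C * (\<Sum>i\<le>m. D i)) * test_energy m \<psi>"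
    if \<psi>: "\<psi> \<in> test_functions UNIV" for \<psi>
  proof -
    have h\<psi>: "(\<lambda>x. h x * \<psi> x) \<in> test_functions UNIV"
      by (rule test_functions_mult(1)[OF \<psi> test_functions_smooth[OF assms(2)]])
    have "(\<Sum>i\<le>m. wform (hweight m) i \<psi> \<psi>) \<le> (\<Sum>i\<le>m. D i * wform (\<lambda>_. 1) m \<psi> \<psi>)"
    proof (rule sum_mono)
      fix i assume "i \<in> {..m}"
      then have i: "i \<le> m" by simp
      \<comment> \<open>A smaller exponent gives a larger weight; m - i is exactly the number of
        powers that i can still turn into derivatives.\<close>
      have "wform (hweight m) i \<psi> \<psi> \<le> wform (hweight (m - i)) i \<psi> \<psi>"
        by (rule wform_weight_mono[OF smooth_hweight smooth_hweight hweight_antimono \<psi>]) simp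
      also have "\<dots> \<le> D i * wform (\<lambda>_. 1) m \<psi> \<psi>" using D i \<psi> by blast
      finally show "wform (hweight m) i \<psi> \<psi> \<le> D i * wform (\<lambda>_. 1) m \<psi> \<psi>" .
    qed
    then have "C * (\<Sum>i\<le>m. wform (hweight m) i \<psi> \<psi>) \<le> C * ((\<Sum>i\<le>m. D i) * wform (\<lambda>_. 1) m \<psi> \<psi>)"
      using C(1) by (simp add: mult_left_mono sum_distrib_right)
    then show ?thesis
      unfolding test_energy_eq_wform[OF \<psi>] test_energy_eq_wform[OF h\<psi>] using C(2)[rule_format, OF \<psi>] by (simp add: mult.assoc)
  qed
  moreover have "C * (\<Sum>i\<le>m. D i) \<ge> 0" using C(1) D by (simp add: sum_nonneg)
  ultimately show ?thesis by blast
qed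

section \<open>The energy on the completion\<close>

lemma test_energy_nonneg: "test_energy m \<phi> \<ge> 0"
  by (simp add: test_energy_def)

lemma test_energy_triangle:
  assumes "\<phi> \<in> test_functions UNIV" "\<psi> \<in> test_functions UNIV"
  shows "sqrt (test_energy m (\<lambda>x. \<phi> x + \<psi> x)) \<le> sqrt (test_energy m \<phi>) + sqrt (test_energy m \<psi>)"
proof -
  have "(\<lambda>x. \<phi> x + \<psi> x) \<in> test_functions UNIV" by (rule test_functions_add[OF assms])
  then show ?thesis
    using wform_triangle[OF smooth_const _ assms, of "1" m]
    by (simp add: test_energy_eq_wform assms)
qed

lemma test_energy_cmult:
  assumes "\<phi> \<in> test_functions UNIV"
  shows "test_energy m (\<lambda>x. c * \<phi> x) = c\<^sup>2 * test_energy m \<phi>"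
  using wform_cmult_cmult[OF assms, of "\<lambda>_. 1" m c] test_functions_cmult[OF assms, of c]
  by (simp add: test_energy_eq_wform assms)

lemma test_energy_uminus:
  assumes "\<phi> \<in> test_functions UNIV"
  shows "test_energy m (\<lambda>x. - \<phi> x) = test_energy m \<phi>"
  using test_energy_cmult[OF assms, of m "-1"] by simp

lemma test_energy_minus_commute:
  assumes "\<phi> \<in> test_functions UNIV" "\<psi> \<in> test_functions UNIV"
  shows "test_energy m (\<lambda>x. \<phi> x - \<psi> x) = test_energy m (\<lambda>x. \<psi> x - \<phi> x)"
  using test_energy_uminus[OF test_functions_diff[OF assms], of m] by simp

lemma test_energy_zero: "test_energy m (\<lambda>x. 0) = 0"
  using test_energy_cmult[OF test_functions_zero, of m 0] by simp

lemma test_energy_triangle_diff: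
  assumes "\<phi> \<in> test_functions UNIV" "\<psi> \<in> test_functions UNIV"
  shows "sqrt (test_energy m (\<lambda>x. \<phi> x - \<psi> x)) \<le> sqrt (test_energy m \<phi>) + sqrt (test_energy m \<psi>)"
  using test_energy_triangle[OF assms(1) test_functions_uminus[OF assms(2)], of m]
  by (simp add: test_energy_uminus[OF assms(2)])

lemma test_energy_reverse_triangle:
  assumes "\<phi> \<in> test_functions UNIV" "\<psi> \<in> test_functions UNIV"
  shows "\<bar>sqrt (test_energy m \<phi>) - sqrt (test_energy m \<psi>)\<bar> \<le> sqrt (test_energy m (\<lambda>x. \<phi> x - \<psi> x))"
proof -
  have "sqrt (test_energy m \<phi>) \<le> sqrt (test_energy m (\<lambda>x. \<phi> x - \<psi> x)) + sqrt (test_energy m \<psi>)"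
    using test_energy_triangle[OF test_functions_diff[OF assms] assms(2), of m] by simp
  moreover have "sqrt (test_energy m \<psi>) \<le> sqrt (test_energy m (\<lambda>x. \<psi> x - \<phi> x)) + sqrt (test_energy m \<phi>)"
    using test_energy_triangle[OF test_functions_diff[OF assms(2,1)] assms(1), of m] by simp
  ultimately show ?thesis
    unfolding test_energy_minus_commute[OF assms(2,1)] by (simp add: abs_le_iff)
qed

lemma critical_exponent_gt_1:
  assumes "2 * m < DIM('a::euclidean_space)"
  shows "critical_exponent m TYPE('a) > 1"
proof -
  have "real DIM('a) - 2 * real m > 0" "real DIM('a) > 0" using assms by auto
  then show ?thesis unfolding critical_exponent_def by (simp add: field_simps)
qed

lemma represents_test_functions: "represents m \<phi> g \<Longrightarrow> \<phi> k \<in> test_functions UNIV"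
  by (simp add: represents_def)

lemma represents_const:
  assumes "\<phi> \<in> test_functions UNIV"
  shows "represents m (\<lambda>_. \<phi>) \<phi>"
  using assms smooth_lebesgue_measurable[OF test_functions_smooth[OF assms]]
  by (simp add: represents_def test_energy_zero)

text \<open>A crude pointwise bound by twice the maximum; it suffices where only convergence to 0 of
  integrals of p-th powers matters.\<close>

lemma powr_diff_le:
  fixes a b p :: real
  assumes "p > 0"
  shows "\<bar>a - b\<bar> powr p \<le> 2 powr p * (\<bar>a\<bar> powr p + \<bar>b\<bar> powr p)"
proof -
  let ?M = "max \<bar>a\<bar> \<bar>b\<bar>"
  have "\<bar>a - b\<bar> \<le> 2 * ?M" by linarith
  then have "\<bar>a - b\<bar> powr p \<le> (2 * ?M) powr p"
    using assms by (intro powr_mono2) auto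
  also have "\<dots> = 2 powr p * ?M powr p" by (simp add: powr_mult)
  also have "?M powr p \<le> \<bar>a\<bar> powr p + \<bar>b\<bar> powr p" by (simp add: max_def)
  finally show ?thesis by simp
qed

lemma represents_diff:
  fixes g :: "'a::euclidean_space \<Rightarrow> real"
  assumes m: "2 * m < DIM('a)" and \<phi>: "represents m \<phi> g" and \<psi>: "represents m \<psi> h"
  shows "represents m (\<lambda>k x. \<phi> k x - \<psi> k x) (\<lambda>x. g x - h x)"
proof -
  let ?p = "critical_exponent m TYPE('a)"
  let ?I = "\<lambda>f. \<integral>\<^sup>+x. ennreal (\<bar>f x\<bar> powr ?p) \<partial>lebesgue"
  note T = represents_test_functions[OF \<phi>] represents_test_functions[OF \<psi>]
  have p: "?p > 0" using critical_exponent_gt_1[OF m] by simp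
  have meas: "g \<in> borel_measurable lebesgue" "h \<in> borel_measurable lebesgue"
    using \<phi> \<psi> by (simp_all add: represents_def)
  have meas': "\<phi> k \<in> borel_measurable lebesgue" "\<psi> k \<in> borel_measurable lebesgue" for k
    using smooth_lebesgue_measurable[OF test_functions_smooth[OF T(1)]]
      smooth_lebesgue_measurable[OF test_functions_smooth[OF T(2)]] .
  have cauchy: "\<exists>M. \<forall>j\<ge>M. \<forall>k\<ge>M. test_energy m (\<lambda>x. (\<phi> j x - \<psi> j x) - (\<phi> k x - \<psi> k x)) < e"
    if e: "e > 0" for e
  proof -
    \<comment> \<open>Quarters, because square roots are what add: sqrt(e/4) + sqrt(e/4) = sqrt
      e.\<close>
    obtain M1 where M1: "\<forall>j\<ge>M1. \<forall>k\<ge>M1. test_energy m (\<lambda>x. \<phi> j x - \<phi> k x) < e / 4"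
      using \<phi> e unfolding represents_def by (meson divide_pos_pos zero_less_numeral)
    obtain M2 where M2: "\<forall>j\<ge>M2. \<forall>k\<ge>M2. test_energy m (\<lambda>x. \<psi> j x - \<psi> k x) < e / 4"
      using \<psi> e unfolding represents_def by (meson divide_pos_pos zero_less_numeral)
    have "test_energy m (\<lambda>x. (\<phi> j x - \<psi> j x) - (\<phi> k x - \<psi> k x)) < e"
      if jk: "j \<ge> max M1 M2" "k \<ge> max M1 M2" for j k
    proof -
      let ?a = "\<lambda>x. \<phi> j x - \<phi> k x" and ?b = "\<lambda>x. \<psi> j x - \<psi> k x"
      have "sqrt (test_energy m ?a) < sqrt (e / 4)" "sqrt (test_energy m ?b) < sqrt (e / 4)"
        using M1 M2 jk by auto
      moreover have "sqrt (test_energy m (\<lambda>x. ?a x - ?b x)) \<le> sqrt (test_energy m ?a) + sqrt (test_energy m ?b)"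
        by (intro test_energy_triangle_diff test_functions_diff T)
      moreover have "sqrt (e / 4) + sqrt (e / 4) = sqrt e" by (simp add: real_sqrt_divide)
      ultimately have "sqrt (test_energy m (\<lambda>x. ?a x - ?b x)) < sqrt e" by linarith
      moreover have "(\<lambda>x. (\<phi> j x - \<psi> j x) - (\<phi> k x - \<psi> k x)) = (\<lambda>x. ?a x - ?b x)"
        by (simp add: fun_eq_iff)
      ultimately show ?thesis by simp
    qed
    then show ?thesis by blast
  qed
  have lim: "(\<lambda>k. ?I (\<lambda>x. (\<phi> k x - \<psi> k x) - (g x - h x))) \<longlonglongrightarrow> 0"
  proof (rule tendsto_sandwich[of "\<lambda>_. 0"])
    have "?I (\<lambda>x. (\<phi> k x - \<psi> k x) - (g x - h x))
        \<le> ennreal (2 powr ?p) * (?I (\<lambda>x. \<phi> k x - g x) + ?I (\<lambda>x. \<psi> k x - h x))" for k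
    proof -
      have "?I (\<lambda>x. (\<phi> k x - \<psi> k x) - (g x - h x))
        \<le> (\<integral>\<^sup>+x. ennreal (2 powr ?p) * (ennreal (\<bar>\<phi> k x - g x\<bar> powr ?p) + ennreal (\<bar>\<psi> k x - h x\<bar> powr ?p)) \<partial>lebesgue)"
      proof (rule nn_integral_mono)
        fix x
        have eq: "(\<phi> k x - \<psi> k x) - (g x - h x) = (\<phi> k x - g x) - (\<psi> k x - h x)" by simp
        have "\<bar>(\<phi> k x - \<psi> k x) - (g x - h x)\<bar> powr ?p
            \<le> 2 powr ?p * (\<bar>\<phi> k x - g x\<bar> powr ?p + \<bar>\<psi> k x - h x\<bar> powr ?p)"
          unfolding eq by (rule powr_diff_le[OF p])
        then show "ennreal (\<bar>(\<phi> k x - \<psi> k x) - (g x - h x)\<bar> powr ?p)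
            \<le> ennreal (2 powr ?p) * (ennreal (\<bar>\<phi> k x - g x\<bar> powr ?p) + ennreal (\<bar>\<psi> k x - h x\<bar> powr ?p))"
          by (simp add: ennreal_mult[symmetric] ennreal_plus[symmetric] ennreal_leI del: ennreal_plus)
      qed
      also have "\<dots> = ennreal (2 powr ?p) * (?I (\<lambda>x. \<phi> k x - g x) + ?I (\<lambda>x. \<psi> k x - h x))"
        using meas meas' by (simp add: nn_integral_cmult nn_integral_add)
      finally show ?thesis .
    qed
    then show "\<forall>\<^sub>F k in sequentially. ?I (\<lambda>x. (\<phi> k x - \<psi> k x) - (g x - h x))
        \<le> ennreal (2 powr ?p) * (?I (\<lambda>x. \<phi> k x - g x) + ?I (\<lambda>x. \<psi> k x - h x))"
      by (intro always_eventually allI)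
    have "(\<lambda>k. ennreal (2 powr ?p) * (?I (\<lambda>x. \<phi> k x - g x) + ?I (\<lambda>x. \<psi> k x - h x)))
        \<longlonglongrightarrow> ennreal (2 powr ?p) * (0 + 0)"
      by (rule ennreal_tendsto_cmult[OF _ tendsto_add]) (use \<phi> \<psi> in \<open>simp_all add: represents_def\<close>)
    then show "(\<lambda>k. ennreal (2 powr ?p) * (?I (\<lambda>x. \<phi> k x - g x) + ?I (\<lambda>x. \<psi> k x - h x))) \<longlonglongrightarrow> 0"
      by simp
  qed auto
  show ?thesis
    unfolding represents_def
    using cauchy lim meas test_functions_diff[OF T] by (intro conjI allI impI) auto
qed

text \<open>Splitting at the height d gives |\<theta>| \<le> d + d^(1-p) |\<theta>|^p, as p > 1. The
  first part is small against the integrable \<open>v\<close>, the second against the bounded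
  \<open>v\<close>, so that convergence of the p-th powers is all that enters.\<close>

lemma represents_zero_weak:
  fixes \<theta> :: "nat \<Rightarrow> 'a::euclidean_space \<Rightarrow> real"
  assumes m: "2 * m < DIM('a)" and \<theta>: "represents m \<theta> (\<lambda>_. 0)" and v: "v \<in> test_functions UNIV"
  shows "(\<lambda>k. LINT x|lebesgue. \<theta> k x * v x) \<longlonglongrightarrow> 0"
proof (rule LIMSEQ_I)
  fix e :: real assume e: "e > 0"
  define p where "p = critical_exponent m TYPE('a)"
  have p: "p > 1" unfolding p_def by (rule critical_exponent_gt_1[OF m])
  obtain V where V: "V > 0" "\<forall>x. \<bar>v x\<bar> \<le> V" using test_functions_bound[OF v] by blast
  define A where "A = (LINT x|lebesgue. \<bar>v x\<bar>)"
  have A: "A \<ge> 0" unfolding A_def by simp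
  \<comment> \<open>The summand 1 covers the case where the integral of |v| is 0.\<close>
  define d where "d = e / (2 * (A + 1))"
  have d: "d > 0" using e A by (simp add: d_def)
  have dA: "d * A < e / 2" using e A by (simp add: d_def field_simps)
  define c where "c = d powr (1 - p) * V"
  have c: "c > 0" using d V by (simp add: c_def)
  have "(\<lambda>k. \<integral>\<^sup>+x. ennreal (\<bar>\<theta> k x\<bar> powr p) \<partial>lebesgue) \<longlonglongrightarrow> 0"
    using \<theta> by (simp add: represents_def p_def)
  moreover have "ennreal (e / (2 * c)) > 0" using e c by simp
  ultimately have "\<forall>\<^sub>F k in sequentially. (\<integral>\<^sup>+x. ennreal (\<bar>\<theta> k x\<bar> powr p) \<partial>lebesgue) < ennreal (e / (2 * c))"
    by (rule order_tendstoD(2))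
  then obtain M where M: "\<And>k. k \<ge> M \<Longrightarrow> (\<integral>\<^sup>+x. ennreal (\<bar>\<theta> k x\<bar> powr p) \<partial>lebesgue) < ennreal (e / (2 * c))"
    unfolding eventually_sequentially by blast
  have "norm ((LINT x|lebesgue. \<theta> k x * v x) - 0) < e" if k: "k \<ge> M" for k
  proof -
    have T: "\<theta> k \<in> test_functions UNIV" by (rule represents_test_functions[OF \<theta>])
    have meas: "\<theta> k \<in> borel_measurable lebesgue"
      by (rule smooth_lebesgue_measurable[OF test_functions_smooth[OF T]])
    have "(\<integral>\<^sup>+x. ennreal (\<bar>\<theta> k x\<bar> powr p) \<partial>lebesgue) < \<infinity>"
      using order.strict_trans[OF M[OF k] ennreal_less_top] by simp
    then have int: "integrable lebesgue (\<lambda>x. \<bar>\<theta> k x\<bar> powr p)"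
      using meas by (intro integrableI_nonneg) auto
    then have "ennreal (LINT x|lebesgue. \<bar>\<theta> k x\<bar> powr p) < ennreal (e / (2 * c))"
      using M[OF k] by (simp add: nn_integral_eq_integral)
    then have small: "(LINT x|lebesgue. \<bar>\<theta> k x\<bar> powr p) < e / (2 * c)"
      using e c by (simp add: ennreal_less_iff)
    have pointwise: "\<bar>\<theta> k x * v x\<bar> \<le> d * \<bar>v x\<bar> + c * \<bar>\<theta> k x\<bar> powr p" for x
    proof (cases "\<bar>\<theta> k x\<bar> \<le> d")
      case True
      then have "\<bar>\<theta> k x * v x\<bar> \<le> d * \<bar>v x\<bar>" by (simp add: abs_mult mult_right_mono)
      moreover have "c * \<bar>\<theta> k x\<bar> powr p \<ge> 0" using c by simp
      ultimately show ?thesis by linarith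
    next
      case False
      then have pos: "\<bar>\<theta> k x\<bar> > 0" using d by linarith
      have "\<bar>\<theta> k x\<bar> = \<bar>\<theta> k x\<bar> powr (1 - p) * \<bar>\<theta> k x\<bar> powr p"
        using pos by (simp add: powr_add[symmetric])
      also have "\<dots> \<le> d powr (1 - p) * \<bar>\<theta> k x\<bar> powr p"
        using False d p by (intro mult_right_mono powr_mono2') auto
      finally have "\<bar>\<theta> k x\<bar> * \<bar>v x\<bar> \<le> (d powr (1 - p) * \<bar>\<theta> k x\<bar> powr p) * V"
        using V by (intro mult_mono) auto
      moreover have "d * \<bar>v x\<bar> \<ge> 0" using d by simp
      ultimately show ?thesis by (simp add: abs_mult c_def algebra_simps)
    qed
    have int_v: "integrable lebesgue (\<lambda>x. \<bar>v x\<bar>)" using test_functions_integrable[OF v] by simp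
    have "\<bar>LINT x|lebesgue. \<theta> k x * v x\<bar> \<le> (LINT x|lebesgue. \<bar>\<theta> k x * v x\<bar>)"
      by (rule integral_abs_bound)
    also have "\<dots> \<le> (LINT x|lebesgue. d * \<bar>v x\<bar> + c * \<bar>\<theta> k x\<bar> powr p)"
    proof (rule integral_mono)
      show "integrable lebesgue (\<lambda>x. \<bar>\<theta> k x * v x\<bar>)"
        by (intro integrable_abs test_functions_integrable test_functions_mult(1) v test_functions_smooth[OF T])
      show "integrable lebesgue (\<lambda>x. d * \<bar>v x\<bar> + c * \<bar>\<theta> k x\<bar> powr p)"
        using int int_v by simp
    qed (rule pointwise)
    also have "\<dots> = d * A + c * (LINT x|lebesgue. \<bar>\<theta> k x\<bar> powr p)"
      using int int_v by (simp add: A_def)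
    also have "\<dots> < e / 2 + c * (e / (2 * c))"
      using dA small c by (intro add_strict_mono mult_strict_left_mono) auto
    also have "\<dots> = e" using c by simp
    finally show ?thesis by simp
  qed
  then show "\<exists>M. \<forall>k\<ge>M. norm ((LINT x|lebesgue. \<theta> k x * v x) - 0) < e" by blast
qed

text \<open>
  Closability: \<open>E(\<theta>\<^sub>k) \<le> E(\<theta>\<^sub>k - \<theta>\<^sub>M) + 2\<langle>\<theta>\<^sub>k, \<theta>\<^sub>M\<rangle>\<close>, and \<open>\<langle>\<theta>\<^sub>k, \<theta>\<^sub>M\<rangle>\<close> tends to zero for fixed \<open>M\<close> because all
  derivatives can be moved to \<open>\<theta>\<^sub>M\<close>.
\<close>

lemma represents_zero:
  fixes \<theta> :: "nat \<Rightarrow> 'a::euclidean_space \<Rightarrow> real"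
  assumes m: "2 * m < DIM('a)" and \<theta>: "represents m \<theta> (\<lambda>_. 0)"
  shows "(\<lambda>k. test_energy m (\<theta> k)) \<longlonglongrightarrow> 0"
proof (rule LIMSEQ_I)
  fix e :: real assume e: "e > 0"
  note T = represents_test_functions[OF \<theta>]
  obtain M where M: "\<forall>j\<ge>M. \<forall>k\<ge>M. test_energy m (\<lambda>x. \<theta> j x - \<theta> k x) < e / 2"
    using \<theta> e unfolding represents_def by (meson half_gt_zero)
  let ?W = "\<lambda>k. wform (\<lambda>_. 1) m (\<theta> k) (\<theta> M)"
  have "(\<lambda>k. (-1) ^ m * (LINT x|lebesgue. \<theta> k x * (laplacian ^^ m) (\<theta> M) x)) \<longlonglongrightarrow> (-1) ^ m * 0"
    by (intro tendsto_mult_left represents_zero_weak[OF m \<theta>] laplacian_funpow_test_functions T)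
  then have "?W \<longlonglongrightarrow> 0" by (simp add: wform_eq_laplacian T)
  from LIMSEQ_D[OF this, of "e / 4"] e obtain M' where M': "\<forall>k\<ge>M'. \<bar>?W k\<bar> < e / 4" by auto
  have "norm (test_energy m (\<theta> k) - 0) < e" if k: "k \<ge> max M M'" for k
  proof -
    have neg: "(\<lambda>x. (-1) * \<theta> M x) \<in> test_functions UNIV" by (rule test_functions_cmult[OF T])
    have "test_energy m (\<lambda>x. \<theta> k x - \<theta> M x) = wform (\<lambda>_. 1) m (\<lambda>x. \<theta> k x + (-1) * \<theta> M x) (\<lambda>x. \<theta> k x + (-1) * \<theta> M x)"
      by (simp add: test_energy_eq_wform test_functions_diff T)
    also have "\<dots> = test_energy m (\<theta> k) + 2 * wform (\<lambda>_. 1) m (\<theta> k) (\<lambda>x. (-1) * \<theta> M x) + test_energy m (\<theta> M)"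
      unfolding wform_add_add[OF smooth_const T neg] wform_cmult_cmult[OF T]
      by (simp add: test_energy_eq_wform T)
    also have "wform (\<lambda>_. 1) m (\<theta> k) (\<lambda>x. (-1) * \<theta> M x) = - ?W k"
      using wform_cmult_left[OF T, of "\<lambda>_. 1" m "-1" M "\<theta> k"]
        wform_sym[of "\<lambda>_. 1" m "\<theta> k" "\<lambda>x. (-1) * \<theta> M x"] wform_sym[of "\<lambda>_. 1" m "\<theta> k" "\<theta> M"] by linarith
    finally have "test_energy m (\<theta> k) + test_energy m (\<theta> M) = test_energy m (\<lambda>x. \<theta> k x - \<theta> M x) + 2 * ?W k"
      by simp
    also have "\<dots> < e / 2 + 2 * (e / 4)"
    proof (rule add_strict_mono)
      show "test_energy m (\<lambda>x. \<theta> k x - \<theta> M x) < e / 2" using M k by simp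
      have "\<bar>?W k\<bar> < e / 4" using M' k by simp
      then show "2 * ?W k < 2 * (e / 4)" by (simp only: abs_less_iff mult_less_cancel_left_pos zero_less_numeral)
    qed
    finally show ?thesis
      using test_energy_nonneg[of m "\<theta> k"] test_energy_nonneg[of m "\<theta> M"] by simp
  qed
  then show "\<exists>M. \<forall>k\<ge>M. norm (test_energy m (\<theta> k) - 0) < e" by blast
qed

text \<open>The square root of the energy is a seminorm, so the reverse triangle inequality carries
  the Cauchy property over to its values.\<close>

lemma represents_sqrt_convergent:
  assumes "represents m \<phi> g"
  shows "convergent (\<lambda>k. sqrt (test_energy m (\<phi> k)))"
proof (rule Cauchy_convergent, rule metric_CauchyI)
  fix e :: real assume e: "e > 0"
  then have "e\<^sup>2 > 0" by simp
  then obtain M where M: "\<forall>j\<ge>M. \<forall>k\<ge>M. test_energy m (\<lambda>x. \<phi> j x - \<phi> k x) < e\<^sup>2"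
    using assms unfolding represents_def by meson
  have "dist (sqrt (test_energy m (\<phi> j))) (sqrt (test_energy m (\<phi> k))) < e" if "j \<ge> M" "k \<ge> M" for j k
  proof -
    have "sqrt (test_energy m (\<lambda>x. \<phi> j x - \<phi> k x)) < sqrt (e\<^sup>2)"
      using M that by (intro real_sqrt_less_mono) auto
    then show ?thesis
      using test_energy_reverse_triangle[of "\<phi> j" "\<phi> k" m] represents_test_functions[OF assms] e
      by (simp add: dist_real_def)
  qed
  then show "\<exists>M. \<forall>j\<ge>M. \<forall>k\<ge>M. dist (sqrt (test_energy m (\<phi> j))) (sqrt (test_energy m (\<phi> k))) < e" by blast
qed

text \<open>The difference of two sequences for the same element represents 0, so by closability its
  energies tend to 0.\<close>

lemma represents_sqrt_limit_unique:
  fixes g :: "'a::euclidean_space \<Rightarrow> real"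
  assumes m: "2 * m < DIM('a)" and \<phi>: "represents m \<phi> g" and \<psi>: "represents m \<psi> g"
    and lim: "(\<lambda>k. sqrt (test_energy m (\<phi> k))) \<longlonglongrightarrow> L"
  shows "(\<lambda>k. sqrt (test_energy m (\<psi> k))) \<longlonglongrightarrow> L"
proof -
  have "represents m (\<lambda>k x. \<phi> k x - \<psi> k x) (\<lambda>_. 0)"
    using represents_diff[OF m \<phi> \<psi>] by simp
  from represents_zero[OF m this]
  have "(\<lambda>k. sqrt (test_energy m (\<lambda>x. \<phi> k x - \<psi> k x))) \<longlonglongrightarrow> sqrt 0"
    by (rule tendsto_real_sqrt)
  then have "(\<lambda>k. sqrt (test_energy m (\<lambda>x. \<phi> k x - \<psi> k x))) \<longlonglongrightarrow> 0" by simp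
  moreover have "\<forall>\<^sub>F k in sequentially. norm (sqrt (test_energy m (\<phi> k)) - sqrt (test_energy m (\<psi> k)))
      \<le> sqrt (test_energy m (\<lambda>x. \<phi> k x - \<psi> k x))"
    by (intro always_eventually allI)
       (simp add: test_energy_reverse_triangle represents_test_functions[OF \<phi>] represents_test_functions[OF \<psi>])
  ultimately have "(\<lambda>k. sqrt (test_energy m (\<phi> k)) - sqrt (test_energy m (\<psi> k))) \<longlonglongrightarrow> 0"
    by (rule Lim_null_comparison[rotated])
  from tendsto_diff[OF lim this] show ?thesis by simp
qed

text \<open>Existence and uniqueness of the limit give the definite description in
  \<open>energy\<close> its value. Square roots are used because the triangle inequality lives
  there.\<close>

lemma represents_energy:
  fixes g :: "'a::euclidean_space \<Rightarrow> real"
  assumes m: "2 * m < DIM('a)" and \<phi>: "represents m \<phi> g"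
  shows "(\<lambda>k. sqrt (test_energy m (\<phi> k))) \<longlonglongrightarrow> sqrt (energy m g)" "energy m g \<ge> 0"
proof -
  obtain L where L: "(\<lambda>k. sqrt (test_energy m (\<phi> k))) \<longlonglongrightarrow> L"
    using represents_sqrt_convergent[OF \<phi>] by (auto simp: convergent_def)
  have L0: "L \<ge> 0" by (rule LIMSEQ_le_const[OF L]) (simp add: test_energy_nonneg)
  have sq: "(\<lambda>k. test_energy m (\<psi> k)) \<longlonglongrightarrow> L\<^sup>2" if "represents m \<psi> g" for \<psi>
    using tendsto_power[OF represents_sqrt_limit_unique[OF m \<phi> that L], of 2]
    by (simp add: test_energy_nonneg)
  have "energy m g = L\<^sup>2"
    unfolding energy_def
  proof (rule the_equality)
    show "\<exists>\<phi>. represents m \<phi> g \<and> (\<lambda>k. test_energy m (\<phi> k)) \<longlonglongrightarrow> L\<^sup>2"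
      using \<phi> sq[OF \<phi>] by blast
    show "E = L\<^sup>2" if "\<exists>\<phi>. represents m \<phi> g \<and> (\<lambda>k. test_energy m (\<phi> k)) \<longlonglongrightarrow> E" for E
      using that sq LIMSEQ_unique by blast
  qed
  then show "(\<lambda>k. sqrt (test_energy m (\<phi> k))) \<longlonglongrightarrow> sqrt (energy m g)" "energy m g \<ge> 0"
    using L L0 by simp_all
qed

lemma energy_nonneg:
  fixes g :: "'a::euclidean_space \<Rightarrow> real"
  assumes "2 * m < DIM('a)" "g \<in> D0 m"
  shows "energy m g \<ge> 0"
  using assms represents_energy(2) unfolding D0_def by blast

lemma test_functions_D0: "\<phi> \<in> test_functions UNIV \<Longrightarrow> \<phi> \<in> D0 m"
  unfolding D0_def using represents_const by blast

lemma energy_test_functions: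
  fixes \<phi> :: "'a::euclidean_space \<Rightarrow> real"
  assumes m: "2 * m < DIM('a)" and \<phi>: "\<phi> \<in> test_functions UNIV"
  shows "energy m \<phi> = test_energy m \<phi>"
proof -
  have "sqrt (test_energy m \<phi>) = sqrt (energy m \<phi>)"
    using represents_energy(1)[OF m represents_const[OF \<phi>]]
    by (rule LIMSEQ_unique[OF tendsto_const])
  then show ?thesis by simp
qed

lemma D0_diff:
  fixes g :: "'a::euclidean_space \<Rightarrow> real"
  assumes "2 * m < DIM('a)" "g \<in> D0 m" "h \<in> D0 m"
  shows "(\<lambda>x. g x - h x) \<in> D0 m"
  using assms represents_diff unfolding D0_def by blast

lemma energy_triangle_diff:
  fixes g :: "'a::euclidean_space \<Rightarrow> real"
  assumes m: "2 * m < DIM('a)" and "g \<in> D0 m" "h \<in> D0 m"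
  shows "sqrt (energy m (\<lambda>x. g x - h x)) \<le> sqrt (energy m g) + sqrt (energy m h)"
proof -
  obtain \<phi> \<psi> where \<phi>: "represents m \<phi> g" and \<psi>: "represents m \<psi> h"
    using assms(2,3) unfolding D0_def by blast
  show ?thesis
  proof (rule LIMSEQ_le)
    show "(\<lambda>k. sqrt (test_energy m (\<lambda>x. \<phi> k x - \<psi> k x))) \<longlonglongrightarrow> sqrt (energy m (\<lambda>x. g x - h x))"
      by (rule represents_energy(1)[OF m represents_diff[OF m \<phi> \<psi>]])
    show "(\<lambda>k. sqrt (test_energy m (\<phi> k)) + sqrt (test_energy m (\<psi> k))) \<longlonglongrightarrow> sqrt (energy m g) + sqrt (energy m h)"
      by (intro tendsto_add represents_energy(1) m \<phi> \<psi>)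
    show "\<exists>M. \<forall>k\<ge>M. sqrt (test_energy m (\<lambda>x. \<phi> k x - \<psi> k x)) \<le> sqrt (test_energy m (\<phi> k)) + sqrt (test_energy m (\<psi> k))"
      using test_energy_triangle_diff represents_test_functions[OF \<phi>] represents_test_functions[OF \<psi>] by blast
  qed
qed

section \<open>Capacities\<close>

lemma zero_D0_on:
  fixes \<Omega> :: "'a::euclidean_space set"
  assumes "2 * m < DIM('a)"
  shows "(\<lambda>x. 0) \<in> D0_on m \<Omega>"
proof -
  have z: "energy m (\<lambda>x::'a. 0 - 0) = 0"
    using energy_test_functions[OF assms test_functions_zero] by (simp add: test_energy_zero)
  have "(\<lambda>x::'a. 0) \<in> D0 m" by (rule test_functions_D0[OF test_functions_zero])
  then show ?thesis
    unfolding D0_on_def using test_functions_zero z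
    by (intro CollectI conjI exI[of _ "\<lambda>k x. 0"]) auto
qed

lemma cutoff_test_functions:
  assumes "compact K" "smooth u"
  shows "(\<lambda>x. cutoff K x * u x) \<in> test_functions UNIV"
  using is_cutoff_cutoff[OF assms(1)] test_functions_mult(2)[OF _ assms(2)]
  by (simp add: is_cutoff_def)

text \<open>Elements of \<open>D0_on\<close> are limits of test functions supported off K. Replacing
  g - a by such an approximation changes the norm of the competitor arbitrarily little, so a strict
  inequality survives, and the new competitor coincides with the prescribed function near K.\<close>

lemma capacity_less_imp_test_functions:
  fixes K :: "'a::euclidean_space set"
  assumes m: "2 * m < DIM('a)" and K: "compact K" and u: "smooth u" and cap: "capacity m K u < c"
  shows "\<exists>\<psi>\<in>test_functions (- K). test_energy m (\<lambda>x. cutoff K x * u x + \<psi> x) < c"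
proof -
  define a where "a x = cutoff K x * u x" for x
  have a: "a \<in> test_functions UNIV" unfolding a_def[abs_def] by (rule cutoff_test_functions[OF K u])
  let ?X = "{energy m g | g. g \<in> D0 m \<and> (\<lambda>x. g x - a x) \<in> D0_on m (- K)}"
  \<comment> \<open>The infimum is informative only over a nonempty set; the cut-off datum itself is
    a competitor.\<close>
  have "energy m a \<in> ?X"
    using test_functions_D0[OF a] zero_D0_on[OF m, of "- K"] by auto
  then have "?X \<noteq> {}" by blast
  moreover have "Inf ?X < c" using cap by (simp add: capacity_def a_def)
  ultimately obtain g where g: "g \<in> D0 m" "(\<lambda>x. g x - a x) \<in> D0_on m (- K)" "energy m g < c"
    using cInf_lessD[of ?X c] by blast
  obtain \<psi> where \<psi>: "\<And>k. \<psi> k \<in> test_functions (- K)"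
    "(\<lambda>k. energy m (\<lambda>x. g x - a x - \<psi> k x)) \<longlonglongrightarrow> 0"
    using g(2) unfolding D0_on_def by blast
  have "sqrt (energy m g) < sqrt c" using g(3) by simp
  moreover have "(\<lambda>k. sqrt (energy m (\<lambda>x. g x - a x - \<psi> k x))) \<longlonglongrightarrow> 0"
    using tendsto_real_sqrt[OF \<psi>(2)] by simp
  ultimately have "\<forall>\<^sub>F k in sequentially. sqrt (energy m (\<lambda>x. g x - a x - \<psi> k x)) < sqrt c - sqrt (energy m g)"
    by (intro order_tendstoD(2)) auto
  then obtain k where k: "sqrt (energy m (\<lambda>x. g x - a x - \<psi> k x)) < sqrt c - sqrt (energy m g)"
    unfolding eventually_sequentially by blast
  have T: "(\<lambda>x. a x + \<psi> k x) \<in> test_functions UNIV"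
    by (rule test_functions_add[OF a test_functions_UNIV[OF \<psi>(1)]])
  have "sqrt (energy m (\<lambda>x. g x - (g x - (a x + \<psi> k x))))
      \<le> sqrt (energy m g) + sqrt (energy m (\<lambda>x. g x - (a x + \<psi> k x)))"
    by (intro energy_triangle_diff m g(1) D0_diff test_functions_D0 T)
  then have "sqrt (energy m (\<lambda>x. a x + \<psi> k x)) \<le> sqrt (energy m g) + sqrt (energy m (\<lambda>x. g x - a x - \<psi> k x))"
    by (simp add: diff_diff_eq)
  also have "\<dots> < sqrt c" using k unfolding less_diff_eq by (simp only: add.commute)
  finally show ?thesis
    using \<psi>(1)[of k] energy_test_functions[OF m T] unfolding a_def by auto
qed

text \<open>The condition is approximate, as in \<open>D0_on\<close>: the function to which this is
  applied is known to equal 1 near the zero set only, and its deviation from the cutoff on the rest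
  of K is removed up to small energy.\<close>

lemma capacity_le_test_energy:
  fixes K :: "'a::euclidean_space set"
  assumes m: "2 * m < DIM('a)" and K: "compact K" and u: "smooth u" and \<phi>: "\<phi> \<in> test_functions UNIV"
    and approx: "\<And>e. e > 0 \<Longrightarrow>
      \<exists>\<psi>\<in>test_functions (- K). test_energy m (\<lambda>x. \<phi> x - cutoff K x * u x - \<psi> x) < e"
  shows "capacity m K u \<le> test_energy m \<phi>"
proof -
  define a where "a x = cutoff K x * u x" for x
  have a: "a \<in> test_functions UNIV" unfolding a_def[abs_def] by (rule cutoff_test_functions[OF K u])
  have \<phi>a: "(\<lambda>x. \<phi> x - a x) \<in> test_functions UNIV" by (rule test_functions_diff[OF \<phi> a])
  let ?X = "{energy m g | g. g \<in> D0 m \<and> (\<lambda>x. g x - a x) \<in> D0_on m (- K)}"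
  have "\<forall>k. \<exists>\<psi>. \<psi> \<in> test_functions (- K) \<and> test_energy m (\<lambda>x. \<phi> x - a x - \<psi> x) < inverse (real (Suc k))"
  proof
    fix k
    have "inverse (real (Suc k)) > 0" by simp
    from approx[OF this] show "\<exists>\<psi>. \<psi> \<in> test_functions (- K) \<and>
        test_energy m (\<lambda>x. \<phi> x - a x - \<psi> x) < inverse (real (Suc k))"
      unfolding a_def by blast
  qed
  from choice[OF this] obtain \<psi> where
    \<psi>: "\<forall>k. \<psi> k \<in> test_functions (- K) \<and> test_energy m (\<lambda>x. \<phi> x - a x - \<psi> k x) < inverse (real (Suc k))" ..
  have E: "energy m (\<lambda>x. \<phi> x - a x - \<psi> k x) = test_energy m (\<lambda>x. \<phi> x - a x - \<psi> k x)" for k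
    using \<psi> by (intro energy_test_functions m test_functions_diff[OF \<phi>a] test_functions_UNIV[of _ "- K"]) auto
  have "(\<lambda>k. energy m (\<lambda>x. \<phi> x - a x - \<psi> k x)) \<longlonglongrightarrow> 0"
    unfolding E
  proof (rule tendsto_sandwich[OF _ _ tendsto_const LIMSEQ_inverse_real_of_nat])
    show "\<forall>\<^sub>F k in sequentially. 0 \<le> test_energy m (\<lambda>x. \<phi> x - a x - \<psi> k x)"
      by (simp add: test_energy_nonneg)
    show "\<forall>\<^sub>F k in sequentially. test_energy m (\<lambda>x. \<phi> x - a x - \<psi> k x) \<le> inverse (real (Suc k))"
      using \<psi> by (intro always_eventually allI less_imp_le) blast
  qed
  then have "(\<lambda>x. \<phi> x - a x) \<in> D0_on m (- K)"
    unfolding D0_on_def using \<psi> test_functions_D0[OF \<phi>a] by blast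
  then have "energy m \<phi> \<in> ?X" using test_functions_D0[OF \<phi>] by blast
  moreover have "bdd_below ?X"
    unfolding bdd_below_def using energy_nonneg[OF m] by blast
  ultimately have "Inf ?X \<le> energy m \<phi>" by (rule cInf_lower)
  then show ?thesis
    unfolding energy_test_functions[OF m \<phi>] by (simp add: capacity_def a_def)
qed

section \<open>Division by a smooth function away from its zeros, and the conclusion\<close>

lemma test_functions_vanishing:
  assumes "\<zeta> \<in> test_functions UNIV" "open W" "K \<subseteq> W" "\<And>x. x \<in> W \<Longrightarrow> \<zeta> x = 0"
  shows "\<zeta> \<in> test_functions (- K)"
proof -
  have "{x. \<zeta> x \<noteq> 0} \<subseteq> - W" using assms(4) by blast
  then have "closure {x. \<zeta> x \<noteq> 0} \<subseteq> - W"
    using assms(2) by (intro closure_minimal) auto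
  then have "closure {x. \<zeta> x \<noteq> 0} \<subseteq> - K" using assms(3) by blast
  then show ?thesis using assms(1) by (simp add: test_functions_def)
qed

text \<open>Half of the minimum of |f| makes the inequality strict; for continuous f the set where
  |f| exceeds the constant is then an open neighbourhood of \<open>S\<close>.\<close>

lemma compact_nonzero_bounded_away:
  fixes f :: "'a::topological_space \<Rightarrow> real"
  assumes "compact S" "continuous_on S f" "\<And>x. x \<in> S \<Longrightarrow> f x \<noteq> 0"
  shows "\<exists>c>0. \<forall>x\<in>S. c < \<bar>f x\<bar>"
proof (cases "S = {}")
  case False
  have "continuous_on S (\<lambda>x. \<bar>f x\<bar>)" using assms(2) by (rule continuous_on_rabs)
  from continuous_attains_inf[OF assms(1) False this]
  obtain x0 where x0: "x0 \<in> S" "\<forall>y\<in>S. \<bar>f x0\<bar> \<le> \<bar>f y\<bar>" by blast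
  then have "\<bar>f x0\<bar> > 0" using assms(3) by simp
  then have "\<forall>x\<in>S. \<bar>f x0\<bar> / 2 < \<bar>f x\<bar>" using x0 by force
  with \<open>\<bar>f x0\<bar> > 0\<close> show ?thesis by (intro exI[of _ "\<bar>f x0\<bar> / 2"]) simp
qed (auto intro: exI[of _ 1])

text \<open>The reciprocal is written as f / f^2, and the denominator is corrected by a flat
  function that is positive exactly where |f| < c. The corrected denominator never vanishes and is
  untouched where |f| > c.\<close>

lemma smooth_reciprocal_off_zeros:
  assumes f: "smooth f" and c: "c > 0"
  shows "\<exists>q. smooth q \<and> (\<forall>x. c < \<bar>f x\<bar> \<longrightarrow> q x * f x = 1)"
proof -
  define d where "d x = f x * f x + flat 1 (c\<^sup>2 - f x * f x)" for x
  have d: "d x \<noteq> 0" for x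
  proof (cases "f x = 0")
    case True
    then show ?thesis using c flat_1_pos[of "c\<^sup>2"] by (simp add: d_def)
  next
    case False
    then have "f x * f x > 0" using not_square_less_zero[of "f x"] by (simp add: less_le)
    then show ?thesis using flat_1_nonneg[of "c\<^sup>2 - f x * f x"] by (simp add: d_def)
  qed
  have "smooth d"
    unfolding d_def[abs_def] by (intro smooth_add smooth_mult smooth_flat smooth_diff smooth_const f)
  then have "smooth (\<lambda>x. f x * inverse (d x))"
    by (intro smooth_mult smooth_inverse f d)
  moreover have "(f x * inverse (d x)) * f x = 1" if "c < \<bar>f x\<bar>" for x
  proof -
    have "c\<^sup>2 < \<bar>f x\<bar>\<^sup>2" using that c by (intro power_strict_mono) auto
    then have "d x = f x * f x" by (simp add: d_def flat_nonpos power2_eq_square)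
    moreover have "f x \<noteq> 0" using that c by auto
    ultimately show ?thesis by (simp add: field_simps)
  qed
  ultimately show ?thesis by (intro exI[of _ "\<lambda>x. f x * inverse (d x)"]) simp
qed

theorem proposition4p10:
  fixes m :: nat and K :: "'a::euclidean_space set" and f :: "'a \<Rightarrow> real"
  assumes "m \<ge> 2" and "DIM('a) > 2 * m"
    and "compact K" and "capacity1 m K > 0"
    and "smooth f"
    and "capacity1 m {x \<in> K. f x = 0} < capacity1 m K"
  shows "capacity m K f > 0"
proof (rule ccontr)
  note m = assms(2) and K = assms(3) and f = assms(5)
  define Z where "Z = {x \<in> K. f x = 0}"
  assume "\<not> capacity m K f > 0"
  then have cap_f: "capacity m K f \<le> 0" by simp
  have "closed {x. f x = 0}"
    by (intro closed_Collect_eq smooth_continuous_on f continuous_on_const)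
  then have "compact (K \<inter> {x. f x = 0})" by (rule compact_Int_closed[OF K])
  moreover have "Z = K \<inter> {x. f x = 0}" by (auto simp: Z_def)
  ultimately have Z: "compact Z" by simp
  define \<eta> where "\<eta> = cutoff K"
  have \<eta>: "\<eta> \<in> test_functions UNIV" and "\<exists>V. open V \<and> K \<subseteq> V \<and> (\<forall>x\<in>V. \<eta> x = 1)"
    using is_cutoff_cutoff[OF K] by (simp_all add: is_cutoff_def \<eta>_def)
  then obtain V where V: "open V" "K \<subseteq> V" "\<forall>x\<in>V. \<eta> x = 1" by blast
  have "capacity m Z (\<lambda>_. 1) < capacity m K (\<lambda>_. 1)" using assms(6) by (simp add: Z_def)
  from capacity_less_imp_test_functions[OF m Z smooth_const this] obtain \<psi>0 where
    \<psi>0: "\<psi>0 \<in> test_functions (- Z)"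
      "test_energy m (\<lambda>x. cutoff Z x * 1 + \<psi>0 x) < capacity m K (\<lambda>_. 1)" by blast
  define \<phi> where "\<phi> x = cutoff Z x * 1 + \<psi>0 x" for x
  have \<phi>: "\<phi> \<in> test_functions UNIV"
    unfolding \<phi>_def[abs_def]
    by (rule test_functions_add[OF cutoff_test_functions[OF Z smooth_const] test_functions_UNIV[OF \<psi>0(1)]])
  obtain U1 where U1: "open U1" "Z \<subseteq> U1" "\<forall>x\<in>U1. cutoff Z x = 1"
    using is_cutoff_cutoff[OF Z] unfolding is_cutoff_def by blast
  \<comment> \<open>The closed support of \<open>\<psi>0\<close> misses Z, so removing it leaves an
    open set around Z on which \<phi> is exactly 1.\<close>
  define U where "U = U1 \<inter> - closure {x. \<psi>0 x \<noteq> 0}"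
  have U: "open U" "Z \<subseteq> U"
    using U1 \<psi>0(1) by (auto simp: U_def test_functions_def)
  have \<phi>1: "\<phi> x = 1" if "x \<in> U" for x
  proof -
    have "x \<notin> closure {x. \<psi>0 x \<noteq> 0}" "cutoff Z x = 1" using that U1(3) by (auto simp: U_def)
    then show ?thesis using zero_outside_support[of x \<psi>0] by (simp add: \<phi>_def)
  qed
  have "compact (K - U)" using K U(1) by (rule compact_diff)
  moreover have "f x \<noteq> 0" if "x \<in> K - U" for x using that U(2) by (auto simp: Z_def)
  ultimately obtain c where c: "c > 0" "\<forall>x\<in>K - U. c < \<bar>f x\<bar>"
    using compact_nonzero_bounded_away[of "K - U" f] smooth_continuous_on[OF f] by blast
  obtain q where q: "smooth q" "\<forall>x. c < \<bar>f x\<bar> \<longrightarrow> q x * f x = 1"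
    using smooth_reciprocal_off_zeros[OF f c(1)] by blast
  define h where "h x = (\<eta> x - \<phi> x) * q x" for x
  have h: "h \<in> test_functions UNIV"
    unfolding h_def[abs_def] by (intro test_functions_mult(2) test_functions_diff \<eta> \<phi> q(1))
  have \<eta>f: "(\<lambda>x. \<eta> x * f x) \<in> test_functions UNIV" by (rule test_functions_mult(2)[OF \<eta> f])
  \<comment> \<open>The error in the factorisation of \<eta> - \<phi> through \<eta>f. Near K it
    vanishes: where \<eta> and \<phi> are both 1, both terms are 0; where |f| > c and \<eta> = 1,
    the factor \<open>q\<close> cancels f.\<close>
  define \<zeta> where "\<zeta> x = (\<eta> x - \<phi> x) - h x * (\<eta> x * f x)" for x
  have \<zeta>: "\<zeta> \<in> test_functions (- K)"
  proof (rule test_functions_vanishing)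
    show "\<zeta> \<in> test_functions UNIV"
      unfolding \<zeta>_def[abs_def]
      by (intro test_functions_diff \<eta> \<phi> test_functions_mult(1)[OF \<eta>f] test_functions_smooth[OF h])
    show "open (V \<inter> (U \<union> {x. c < \<bar>f x\<bar>}))"
      by (intro open_Int open_Un V(1) U(1) open_Collect_less continuous_on_const
          continuous_on_rabs smooth_continuous_on f)
    show "K \<subseteq> V \<inter> (U \<union> {x. c < \<bar>f x\<bar>})" using V(2) c(2) by blast
    show "\<zeta> x = 0" if x: "x \<in> V \<inter> (U \<union> {x. c < \<bar>f x\<bar>})" for x
    proof (cases "x \<in> U")
      case True
      then show ?thesis using x V(3) \<phi>1 by (simp add: \<zeta>_def h_def)
    next
      case False
      then have "q x * f x = 1" "\<eta> x = 1" using x V(3) q(2) by auto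
      then show ?thesis by (simp add: \<zeta>_def h_def)
    qed
  qed
  obtain C where C: "C \<ge> 0" "\<forall>\<psi>. \<psi> \<in> test_functions UNIV \<longrightarrow>
      test_energy m (\<lambda>x. h x * \<psi> x) \<le> C * test_energy m \<psi>"
    using test_energy_mult[OF m h] by blast
  have "capacity m K (\<lambda>_. 1) \<le> test_energy m \<phi>"
  proof (rule capacity_le_test_energy[OF m K smooth_const \<phi>])
    fix e :: real assume e: "e > 0"
    \<comment> \<open>With C + 1 the quotient makes sense and C e / (C + 1) < e holds even for C =
      0.\<close>
    then have "capacity m K f < e / (C + 1)"
      using cap_f C(1) by (intro order.strict_trans1[OF cap_f]) simp
    from capacity_less_imp_test_functions[OF m K f this] obtain \<psi> where
      \<psi>: "\<psi> \<in> test_functions (- K)" "test_energy m (\<lambda>x. \<eta> x * f x + \<psi> x) < e / (C + 1)"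
      unfolding \<eta>_def by blast
    let ?u = "\<lambda>x. \<eta> x * f x + \<psi> x"
    have u: "?u \<in> test_functions UNIV" by (rule test_functions_add[OF \<eta>f test_functions_UNIV[OF \<psi>(1)]])
    have hu: "(\<lambda>x. h x * ?u x) \<in> test_functions UNIV"
      by (rule test_functions_mult(1)[OF u test_functions_smooth[OF h]])
    \<comment> \<open>Chosen so that \<phi> - \<eta> - \<open>\<psi>'\<close> equals -h(\<eta>f +
      \<psi>): the error \<zeta> is supported off K and can be absorbed, which leaves only a product
      of small energy.\<close>
    define \<psi>' where "\<psi>' x = h x * \<psi> x - \<zeta> x" for x
    have \<psi>': "\<psi>' \<in> test_functions (- K)"
      unfolding \<psi>'_def[abs_def] by (intro test_functions_diff test_functions_mult(1) \<psi>(1) \<zeta> test_functions_smooth[OF h])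
    have "(\<lambda>x. \<phi> x - cutoff K x * 1 - \<psi>' x) = (\<lambda>x. - (h x * ?u x))"
      by (simp add: fun_eq_iff \<psi>'_def \<zeta>_def \<eta>_def algebra_simps)
    then have "test_energy m (\<lambda>x. \<phi> x - cutoff K x * 1 - \<psi>' x) = test_energy m (\<lambda>x. h x * ?u x)"
      using test_energy_uminus[OF hu, of m] by simp
    also have "\<dots> \<le> C * test_energy m ?u" using C(2) u by blast
    also have "\<dots> \<le> C * (e / (C + 1))" using \<psi>(2) C(1) by (intro mult_left_mono) auto
    also have "\<dots> < e" using e C(1) by (simp add: field_simps)
    finally show "\<exists>\<psi>\<in>test_functions (- K). test_energy m (\<lambda>x. \<phi> x - cutoff K x * 1 - \<psi> x) < e"
      using \<psi>' by blast
  qed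
  moreover have "test_energy m \<phi> < capacity m K (\<lambda>_. 1)"
    using \<psi>0(2) by (simp add: \<phi>_def[abs_def])
  ultimately show False by simp
qed

end
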